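(* Let $\mathcal{G}=(V,(V_1,V_2,V_P),\delta)$ with reward function $r$ be a stochastic game with rewards that is stopping under fairness. Then for every vertex $v\in V$, $\sup_{\pi_1\in\Pi_1^{SM}}\inf_{\pi_2\in\Pi_2^{MF}}\mathbb{E}^{\pi_1,\pi_2}_{\mathcal{G},v}[\mathrm{rew}]=\sup_{\pi_1\in\Pi_1^{M}}\inf_{\pi_2\in\Pi_2^{MF}}\mathbb{E}^{\pi_1,\pi_2}_{\mathcal{G},v}[\mathrm{rew}]$, where $\Pi_1^{SM}$ is the set of semi-Markov Player 1 strategies, $\Pi_1^{M}$ the set of memoryless Player 1 strategies, and $\Pi_2^{MF}$ the set of memoryless fair Player 2 strategies.
   Context: A stochastic game is a tuple $\mathcal{G}=(V,(V_1,V_2,V_P),\delta)$ where $V$ is a finite set of vertices, $V_1,V_2,V_P$ form a partition of $V$, and $\delta:V\times V\to[0,1]$ satisfies $\delta(v,v')\in\{0,1\}$ for $v\in V_1\cup V_2$, $v'\in V$, and $\delta(v,\cdot)$ is a probability distribution on $V$ for $v\in V_P$. Let $\mathrm{post}(v)=\{v'\mid \delta(v,v')>0\}$; it is assumed $\mathrm{post}(v)\neq\emptyset$ for all $v$. A vertex $v$ is terminal if $\delta(v,v)=1$ and $\delta(v,v')=0$ for $v'\neq v$; $T$ is the set of terminal vertices. A path is an infinite sequence $\omega=v_0v_1\dots$ with $\delta(v_k,v_{k+1})>0$ for all $k$; $\inf(\omega)$ is the set of vertices occurring infinitely often in $\omega$. A strategy for Player $i\in\{1,2\}$ is a function $\pi_i:V^*V_i\to\mathcal{D}(V)$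 with $\pi_i(\hat\omega u)(u')>0$ only if $u'\in\mathrm{post}(u)$; it is memoryless if $\pi_i(\hat\omega u)$ depends only on $u$, and semi-Markov if $\pi_i(u\hat\omega u')=\pi_i(u\hat\omega' u')$ for every $u\in V$ and all $\hat\omega,\hat\omega'\in V^*$ with $|\hat\omega|=|\hat\omega'|$. Given strategies $\pi_1,\pi_2$ and initial vertex $v$, $\Pr^{\pi_1,\pi_2}_{\mathcal{G},v}$ is the induced probability measure on paths starting at $v$. $\Diamond T$ is the set of paths visiting $T$. Fair plays: $FP^2=\{\omega\mid \forall v'\in V_2:\ v'\in\inf(\omega)\Rightarrow \mathrm{post}(v')\subseteq\inf(\omega)\}$; a Player 2 strategy $\pi_2$ is fair if $\Pr^{\pi_1,\pi_2}_{\mathcal{G},u}(FP^2)=1$ for every Player 1 strategy $\pi_1$ and every $u\in V$. $\mathcal{G}$ is stopping under fairness if $\Pr^{\pi_1,\pi_2}_{\mathcal{G},u}(\Diamond T)=1$ for all Player 1 strategies $\pi_1$, all fair Player 2 strategies $\pi_2$, and all $u\in V$. A stochastic game with rewards additionally has a reward function $r:V\to\mathbb{R}_{\ge0}$ with $r(u)=0$ for every terminal $u$; $\mathrm{rew}(\omega)=\sum_{i\ge0}r(\omega_i)$ and $\mathbb{E}^{\pi_1,\pi_2}_{\mathcal{G},v}[\mathrm{rew}]$ is the expectation of $\mathrm{rew}$ under $\Pr^{\pi_1,\pi_2}_{\mathcal{G},v}$. *)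

theory Defs
  imports "HOL-Probability.Probability"
begin

text \<open>
  The finite vertex set is the universe of the type \<open>'v::finite\<close>. Hence \<open>V\<^sup>*\<close> is \<open>'v list\<close>,
  and quantification over vertices needs no side condition.
\<close>

record 'v game =
  V1 :: "'v set"
  V2 :: "'v set"
  VP :: "'v set"
  delta :: "'v \<Rightarrow> 'v \<Rightarrow> real"

definition post :: "'v game \<Rightarrow> 'v \<Rightarrow> 'v set" where
  "post G u = {u'. delta G u u' > 0}"

definition stochastic_game :: "('v::finite) game \<Rightarrow> bool" where
  "stochastic_game G \<longleftrightarrow>
     V1 G \<union> V2 G \<union> VP G = UNIV \<and>
     V1 G \<inter> V2 G = {} \<and> V1 G \<inter> VP G = {} \<and> V2 G \<inter> VP G = {} \<and>
     (\<forall>u u'. 0 \<le> delta G u u' \<and> delta G u u' \<le> 1) \<and>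
     (\<forall>u\<in>V1 G \<union> V2 G. \<forall>u'. delta G u u' \<in> {0, 1}) \<and>
     (\<forall>u\<in>VP G. (\<Sum>u'\<in>UNIV. delta G u u') = 1) \<and>
     (\<forall>u. post G u \<noteq> {})"

definition terminal :: "'v game \<Rightarrow> 'v \<Rightarrow> bool" where
  "terminal G u \<longleftrightarrow> delta G u u = 1 \<and> (\<forall>u'. u' \<noteq> u \<longrightarrow> delta G u u' = 0)"

definition reward_function :: "'v game \<Rightarrow> ('v \<Rightarrow> real) \<Rightarrow> bool" where
  "reward_function G r \<longleftrightarrow> (\<forall>u. 0 \<le> r u) \<and> (\<forall>u. terminal G u \<longrightarrow> r u = 0)"


subsection \<open>Strategies\<close>

text \<open>
  A strategy is a total function on histories; only its values on nonempty histories ending in a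
  vertex of its owner (\<open>V\<^sup>*V\<^sub>i\<close>) are constrained or used. The argument \<open>U\<close> below is \<open>V\<^sub>1\<close> or \<open>V\<^sub>2\<close>.
\<close>

type_synonym 'v strategy = "'v list \<Rightarrow> 'v pmf"

definition strategy :: "'v game \<Rightarrow> 'v set \<Rightarrow> 'v strategy \<Rightarrow> bool" where
  "strategy G U \<pi> \<longleftrightarrow>
     (\<forall>w. \<forall>u\<in>U. \<forall>u'. pmf (\<pi> (w @ [u])) u' > 0 \<longrightarrow> u' \<in> post G u)"

definition memoryless :: "'v set \<Rightarrow> 'v strategy \<Rightarrow> bool" where
  "memoryless U \<pi> \<longleftrightarrow> (\<forall>w w'. \<forall>u\<in>U. \<pi> (w @ [u]) = \<pi> (w' @ [u]))"

definition semi_Markov :: "'v set \<Rightarrow> 'v strategy \<Rightarrow> bool" where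
  "semi_Markov U \<pi> \<longleftrightarrow>
     (\<forall>u w w'. \<forall>u'\<in>U. length w = length w' \<longrightarrow> \<pi> (u # w @ [u']) = \<pi> (u # w' @ [u']))"


subsection \<open>The induced probability measure\<close>

definition next_vertex :: "'v game \<Rightarrow> 'v strategy \<Rightarrow> 'v strategy \<Rightarrow> 'v list \<Rightarrow> 'v pmf" where
  "next_vertex G \<pi>1 \<pi>2 h =
     (if last h \<in> V1 G then \<pi>1 h
      else if last h \<in> V2 G then \<pi>2 h
      else embed_pmf (delta G (last h)))"

definition path_kernel ::
  "'v game \<Rightarrow> 'v strategy \<Rightarrow> 'v strategy \<Rightarrow> 'v \<Rightarrow> nat \<Rightarrow> (nat \<Rightarrow> 'v) \<Rightarrow> 'v measure" where
  "path_kernel G \<pi>1 \<pi>2 v i \<omega> =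
     measure_pmf (if i = 0 then return_pmf v else next_vertex G \<pi>1 \<pi>2 (map \<omega> [0..<i]))"

lemma Ionescu_Tulcea_path_kernel:
  "Ionescu_Tulcea (path_kernel G \<pi>1 \<pi>2 (v :: 'v::finite)) (\<lambda>_. count_space UNIV)"
proof (rule Ionescu_Tulcea.intro)
  fix i :: nat
  have "PiM {0..<i} (\<lambda>_. count_space (UNIV :: 'v set)) = count_space (PiE {0..<i} (\<lambda>_. UNIV))"
    by (rule count_space_PiM_finite) auto
  then show "path_kernel G \<pi>1 \<pi>2 v i
      \<in> PiM {0..<i} (\<lambda>_. count_space UNIV) \<rightarrow>\<^sub>M subprob_algebra (count_space UNIV)"
    by (simp add: path_kernel_def[abs_def] measure_pmf_in_subprob_algebra)
next
  show "prob_space (path_kernel G \<pi>1 \<pi>2 v i \<omega>)" for i \<omega>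
    by (simp add: path_kernel_def measure_pmf.prob_space_axioms)
qed

text \<open>
  \<open>path_measure G \<pi>1 \<pi>2 v\<close> is the Ionescu-Tulcea measure, on the product \<open>\<sigma>\<close>-algebra over all vertex
  sequences, given by the initial vertex \<open>v\<close> and the one-step distributions \<open>next_vertex\<close>; lemma
  \<open>emeasure_path_measure_cylinder\<close> gives its values on cylinders.
\<close>

definition path_measure ::
  "('v::finite) game \<Rightarrow> 'v strategy \<Rightarrow> 'v strategy \<Rightarrow> 'v \<Rightarrow> (nat \<Rightarrow> 'v) measure" where
  "path_measure G \<pi>1 \<pi>2 v =
     projective_family.lim UNIV
       (Ionescu_Tulcea.CI (path_kernel G \<pi>1 \<pi>2 v) (\<lambda>_. count_space UNIV))
       (\<lambda>_. count_space UNIV)"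

context
  fixes G :: "('v::finite) game" and \<pi>1 \<pi>2 :: "'v strategy" and v :: 'v
begin

private abbreviation "M \<equiv> \<lambda>_::nat. count_space (UNIV :: 'v set)"

interpretation IT: Ionescu_Tulcea "path_kernel G \<pi>1 \<pi>2 v" M
  by (rule Ionescu_Tulcea_path_kernel)

lemma sets_path_measure [measurable_cong]:
  "sets (path_measure G \<pi>1 \<pi>2 v) = sets (PiM UNIV (\<lambda>_. count_space UNIV))"
  unfolding path_measure_def by (rule IT.PF.sets_lim)

lemma space_path_measure [simp]: "space (path_measure G \<pi>1 \<pi>2 v) = UNIV"
  using sets_eq_imp_space_eq[OF sets_path_measure] by (simp add: space_PiM)

private lemma sets_PiM_finite:
  "sets (PiM {0..<n} M) = Pow (PiE {0..<n} (\<lambda>_. UNIV))"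
  using count_space_PiM_finite[of "{0..<n}" "\<lambda>_. UNIV :: 'v set"] by simp

private lemma emeasure_C_singleton:
  "emeasure (IT.C 0 n (\<lambda>_. undefined)) {restrict x {0..<n}} =
     (\<Prod>i<n. emeasure (path_kernel G \<pi>1 \<pi>2 v i x) {x i})"
proof (induction n)
  case 0
  show ?case by (simp add: sets_PiM_finite PiM_empty)
next
  case (Suc n)
  let ?u = "\<lambda>_::nat. undefined :: 'v"
  have u: "?u \<in> space (PiM {0..<0} M)" by (simp add: space_PiM)
  have A: "{restrict x {0..<Suc n}} \<in> sets (PiM {0..<Suc n} M)"
    by (auto simp: sets_PiM_finite)
  have sp: "space (IT.C 0 n ?u) = PiE {0..<n} (\<lambda>_. UNIV)"
    using IT.space_C[OF u, of n] by (simp add: space_PiM)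
  have "emeasure (IT.C 0 (Suc n) ?u) {restrict x {0..<Suc n}} =
     (\<integral>\<^sup>+\<omega>. emeasure (IT.eP n \<omega>) {restrict x {0..<Suc n}} \<partial>IT.C 0 n ?u)"
    unfolding IT.C.simps add_0
  proof (rule emeasure_bind)
    show "space (IT.C 0 n ?u) \<noteq> {}" by (simp add: sp PiE_eq_empty_iff)
    show "IT.eP n \<in> IT.C 0 n ?u \<rightarrow>\<^sub>M subprob_algebra (PiM {0..<Suc n} M)"
      using IT.measurable_eP[of n] IT.sets_C[OF u, of n] by (simp cong: measurable_cong_sets)
  qed (rule A)
  also have "\<dots> = (\<integral>\<^sup>+\<omega>. emeasure (path_kernel G \<pi>1 \<pi>2 v n x) {x n} *
      indicator {restrict x {0..<n}} \<omega> \<partial>IT.C 0 n ?u)"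
  proof (rule nn_integral_cong)
    fix \<omega> assume "\<omega> \<in> space (IT.C 0 n ?u)"
    then have \<omega>: "\<omega> \<in> PiE {0..<n} (\<lambda>_. UNIV)" by (simp add: sp)
    then have sp\<omega>: "\<omega> \<in> space (PiM {0..<n} M)" by (simp add: space_PiM)
    have eq: "emeasure (IT.eP n \<omega>) {restrict x {0..<Suc n}} =
       emeasure (path_kernel G \<pi>1 \<pi>2 v n \<omega>) {z. fun_upd \<omega> n z = restrict x {0..<Suc n}}"
      using IT.emeasure_eP[OF sp\<omega> A] by (simp add: vimage_def)
    show "emeasure (IT.eP n \<omega>) {restrict x {0..<Suc n}} =
        emeasure (path_kernel G \<pi>1 \<pi>2 v n x) {x n} * indicator {restrict x {0..<n}} \<omega>"
    proof (cases "\<omega> = restrict x {0..<n}")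
      case True
      have "{z. fun_upd \<omega> n z = restrict x {0..<Suc n}} = {x n}"
        using True by (auto simp: fun_eq_iff)
      moreover have "path_kernel G \<pi>1 \<pi>2 v n \<omega> = path_kernel G \<pi>1 \<pi>2 v n x"
      proof -
        have "map \<omega> [0..<n] = map x [0..<n]" using True by simp
        then show ?thesis unfolding path_kernel_def by (simp only:)
      qed
      ultimately show ?thesis using True eq by simp
    next
      case False
      have "fun_upd \<omega> n z \<noteq> restrict x {0..<Suc n}" for z
      proof
        assume *: "fun_upd \<omega> n z = restrict x {0..<Suc n}"
        have "\<omega> i = restrict x {0..<n} i" for i
          using fun_cong[OF *, of i] PiE_arb[OF \<omega>, of i] by (cases "i < n"; cases "i = n") auto
        with False show False by auto
      qed
      then show ?thesis using False eq by simp
    qed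
  qed
  also have "\<dots> = emeasure (path_kernel G \<pi>1 \<pi>2 v n x) {x n} *
      emeasure (IT.C 0 n ?u) {restrict x {0..<n}}"
    by (rule nn_integral_cmult_indicator)
       (use IT.sets_C[OF u, of n] in \<open>auto simp: sets_PiM_finite\<close>)
  finally show ?case
    unfolding Suc.IH prod.lessThan_Suc by (simp only: mult.commute)
qed

lemma emeasure_path_measure_cylinder:
  "emeasure (path_measure G \<pi>1 \<pi>2 v) {\<omega>. \<forall>i\<le>n. \<omega> i = x i} =
     indicator {v} (x 0) * (\<Prod>i<n. pmf (next_vertex G \<pi>1 \<pi>2 (map x [0..<Suc i])) (x (Suc i)))"
proof -
  let ?N = "{0..<Suc n}"
  have A: "{restrict x ?N} \<in> sets (PiM ?N M)"
    by (auto simp: sets_PiM_finite)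
  have "{\<omega>. \<forall>i\<le>n. \<omega> i = x i} = prod_emb UNIV M ?N {restrict x ?N}"
    by (auto simp: prod_emb_iff space_PiM restrict_def fun_eq_iff less_Suc_eq_le) metis
  then have "emeasure (path_measure G \<pi>1 \<pi>2 v) {\<omega>. \<forall>i\<le>n. \<omega> i = x i} =
      emeasure (IT.CI ?N) {restrict x ?N}"
    unfolding path_measure_def using IT.lim[OF _ A] by simp
  also have "\<dots> = emeasure (IT.C 0 (Suc n) (\<lambda>_. undefined)) {restrict x ?N}"
    using IT.emeasure_CI[OF subset_refl A]
    by (simp add: prod_emb_id sets_PiM_finite)
  also have "\<dots> = (\<Prod>i<Suc n. emeasure (path_kernel G \<pi>1 \<pi>2 v i x) {x i})"
    by (rule emeasure_C_singleton)
  finally show ?thesis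
    by (simp add: prod.lessThan_Suc_shift path_kernel_def emeasure_pmf_single prod_ennreal
          ennreal_mult' indicator_def del: upt_Suc prod.lessThan_Suc)
qed

lemma prob_space_path_measure: "prob_space (path_measure G \<pi>1 \<pi>2 v)"
proof (rule prob_space_distrD)
  show "(\<lambda>\<omega>. restrict \<omega> {}) \<in> path_measure G \<pi>1 \<pi>2 v \<rightarrow>\<^sub>M PiM {} M"
    by measurable
  show "prob_space (distr (path_measure G \<pi>1 \<pi>2 v) (PiM {} M) (\<lambda>\<omega>. restrict \<omega> {}))"
    unfolding path_measure_def using IT.distr_lim[of "{}"] IT.PF.prob_space_P[of "{}"] by simp
qed

end

lemma pmf_next_vertex_VP:
  assumes G: "stochastic_game G" and u: "last h \<in> VP G"
  shows "pmf (next_vertex G \<pi>1 \<pi>2 h) u' = delta G (last h) u'"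
proof -
  have "pmf (embed_pmf (delta G (last h))) u' = delta G (last h) u'"
    using G u
    by (intro pmf_embed_pmf)
       (auto simp: stochastic_game_def nn_integral_count_space_finite sum_ennreal)
  moreover have "last h \<notin> V1 G" "last h \<notin> V2 G"
    using G u by (auto simp: stochastic_game_def)
  ultimately show ?thesis by (simp add: next_vertex_def)
qed


subsection \<open>Fairness and expected total reward\<close>

definition is_path :: "'v game \<Rightarrow> (nat \<Rightarrow> 'v) \<Rightarrow> bool" where
  "is_path G \<omega> \<longleftrightarrow> (\<forall>k. delta G (\<omega> k) (\<omega> (Suc k)) > 0)"

definition inf_vertices :: "(nat \<Rightarrow> 'v) \<Rightarrow> 'v set" where
  "inf_vertices \<omega> = {u. \<exists>\<^sub>\<infinity>k. \<omega> k = u}"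

definition fair_plays :: "'v game \<Rightarrow> (nat \<Rightarrow> 'v) set" where
  "fair_plays G =
     {\<omega>. is_path G \<omega> \<and> (\<forall>u\<in>V2 G. u \<in> inf_vertices \<omega> \<longrightarrow> post G u \<subseteq> inf_vertices \<omega>)}"

definition reach_terminal :: "'v game \<Rightarrow> (nat \<Rightarrow> 'v) set" where
  "reach_terminal G = {\<omega>. is_path G \<omega> \<and> (\<exists>k. terminal G (\<omega> k))}"

definition fair_strategy :: "('v::finite) game \<Rightarrow> 'v strategy \<Rightarrow> bool" where
  "fair_strategy G \<pi>2 \<longleftrightarrow>
     strategy G (V2 G) \<pi>2 \<and>
     (\<forall>\<pi>1 u. strategy G (V1 G) \<pi>1 \<longrightarrow> measure (path_measure G \<pi>1 \<pi>2 u) (fair_plays G) = 1)"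

definition stopping_under_fairness :: "('v::finite) game \<Rightarrow> bool" where
  "stopping_under_fairness G \<longleftrightarrow>
     (\<forall>\<pi>1 \<pi>2 u. strategy G (V1 G) \<pi>1 \<longrightarrow> fair_strategy G \<pi>2 \<longrightarrow>
        measure (path_measure G \<pi>1 \<pi>2 u) (reach_terminal G) = 1)"

definition total_reward :: "('v \<Rightarrow> real) \<Rightarrow> (nat \<Rightarrow> 'v) \<Rightarrow> ennreal" where
  "total_reward r \<omega> = (\<Sum>i. ennreal (r (\<omega> i)))"

definition expected_reward ::
  "('v::finite) game \<Rightarrow> ('v \<Rightarrow> real) \<Rightarrow> 'v strategy \<Rightarrow> 'v strategy \<Rightarrow> 'v \<Rightarrow> ennreal" where
  "expected_reward G r \<pi>1 \<pi>2 v = (\<integral>\<^sup>+\<omega>. total_reward r \<omega> \<partial>path_measure G \<pi>1 \<pi>2 v)"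

definition semi_Markov_strategies1 :: "'v game \<Rightarrow> 'v strategy set" where
  "semi_Markov_strategies1 G = {\<pi>1. strategy G (V1 G) \<pi>1 \<and> semi_Markov (V1 G) \<pi>1}"

definition memoryless_strategies1 :: "'v game \<Rightarrow> 'v strategy set" where
  "memoryless_strategies1 G = {\<pi>1. strategy G (V1 G) \<pi>1 \<and> memoryless (V1 G) \<pi>1}"

definition memoryless_fair_strategies2 :: "('v::finite) game \<Rightarrow> 'v strategy set" where
  "memoryless_fair_strategies2 G = {\<pi>2. fair_strategy G \<pi>2 \<and> memoryless (V2 G) \<pi>2}"


subsection \<open>Measurability\<close>

lemma sets_fair_plays [measurable]: "fair_plays G \<in> sets (path_measure G' \<pi>1 \<pi>2 v)"
proof -
  have "fair_plays G = {\<omega> \<in> space (path_measure G' \<pi>1 \<pi>2 v). is_path G \<omega> \<and>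
     (\<forall>u\<in>V2 G. u \<in> inf_vertices \<omega> \<longrightarrow> (\<forall>u'\<in>post G u. u' \<in> inf_vertices \<omega>))}"
    by (auto simp: fair_plays_def)
  also have "\<dots> \<in> sets (path_measure G' \<pi>1 \<pi>2 v)"
    unfolding is_path_def inf_vertices_def mem_Collect_eq INFM_nat by measurable
  finally show ?thesis .
qed

lemma sets_reach_terminal [measurable]: "reach_terminal G \<in> sets (path_measure G' \<pi>1 \<pi>2 v)"
proof -
  have "reach_terminal G = {\<omega> \<in> space (path_measure G' \<pi>1 \<pi>2 v).
     is_path G \<omega> \<and> (\<exists>k. terminal G (\<omega> k))}"
    by (auto simp: reach_terminal_def)
  also have "\<dots> \<in> sets (path_measure G' \<pi>1 \<pi>2 v)"
    unfolding is_path_def by measurable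
  finally show ?thesis .
qed

lemma measurable_total_reward [measurable]:
  "total_reward r \<in> borel_measurable (path_measure G \<pi>1 \<pi>2 v)"
  unfolding total_reward_def[abs_def] by measurable

end

theory Submission
  imports Defs
begin

text \<open>
  Force Player 2 to mix the uniform distribution, with weight \<open>1 / (n + 1)\<close>, into every choice. The
  least fixed point \<open>g n\<close> of the corresponding Bellman operator is finite, because the game is
  stopping, and a minimizing choice of Player 2 has full support, hence is fair, and guarantees at
  most \<open>g n\<close> against every strategy of Player 1. As \<open>n\<close> grows, \<open>g n\<close> decreases to a function \<open>w\<close> with
  \<open>w \<le> bellman w\<close> for the original game. If Player 1 memorylessly chooses successors maximizing
  \<open>w\<close>, then the accumulated reward plus \<open>w\<close> is a submartingale, and since \<open>w\<close> vanishes on terminal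
  vertices, which are reached almost surely against fair strategies, its expectation tends to
  the expected total reward. So this strategy guarantees \<open>w\<close>, which is the supremum for both
  classes of strategies.
\<close>

subsection \<open>Finite histories\<close>

text \<open>The law of the first \<open>n + 1\<close> vertices. As an iterated
  \<open>bind_pmf\<close> it lets integrals be handled by induction over single steps.\<close>

primrec history_pmf :: "'v game \<Rightarrow> 'v strategy \<Rightarrow> 'v strategy \<Rightarrow> 'v \<Rightarrow> nat \<Rightarrow> 'v list pmf" where
  "history_pmf G \<pi>1 \<pi>2 v 0 = return_pmf [v]"
| "history_pmf G \<pi>1 \<pi>2 v (Suc n) =
     bind_pmf (history_pmf G \<pi>1 \<pi>2 v n)
       (\<lambda>h. map_pmf (\<lambda>u. h @ [u]) (next_vertex G \<pi>1 \<pi>2 h))"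

lemma length_history_pmf: "h \<in> set_pmf (history_pmf G \<pi>1 \<pi>2 v n) \<Longrightarrow> length h = Suc n"
  by (induction n arbitrary: h) auto

text \<open>The right-hand side is that of \<open>emeasure_path_measure_cylinder\<close>, so that
  the two laws can be compared on single histories.\<close>

lemma pmf_history_pmf:
  "ennreal (pmf (history_pmf G \<pi>1 \<pi>2 v n) (map x [0..<Suc n])) =
     indicator {v} (x 0) * (\<Prod>i<n. pmf (next_vertex G \<pi>1 \<pi>2 (map x [0..<Suc i])) (x (Suc i)))"
proof (induction n)
  case 0
  show ?case by (auto simp: indicator_def)
next
  case (Suc n)
  let ?h = "map x [0..<Suc n]" and ?H = "history_pmf G \<pi>1 \<pi>2 v n"
  \<comment> \<open>Only the prefix \<open>?h\<close> can be extended to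
    \<open>?h @ [x (Suc n)]\<close>, so the integral over prefixes collapses to one term.\<close>
  have eq: "ennreal (pmf (map_pmf (\<lambda>u. h @ [u]) (next_vertex G \<pi>1 \<pi>2 h)) (?h @ [x (Suc n)])) =
      ennreal (pmf (next_vertex G \<pi>1 \<pi>2 ?h) (x (Suc n))) * indicator {?h} h" for h
  proof (cases "h = ?h")
    case True
    then show ?thesis
      using pmf_map_inj'[of "\<lambda>u. h @ [u]" "next_vertex G \<pi>1 \<pi>2 h" "x (Suc n)"]
      by (simp add: inj_on_def)
  next
    case False
    then have "?h @ [x (Suc n)] \<notin> set_pmf (map_pmf (\<lambda>u. h @ [u]) (next_vertex G \<pi>1 \<pi>2 h))"
      by auto
    then show ?thesis using False by (simp add: pmf_eq_0_set_pmf del: upt_Suc)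
  qed
  have "ennreal (pmf (history_pmf G \<pi>1 \<pi>2 v (Suc n)) (map x [0..<Suc (Suc n)])) =
      (\<integral>\<^sup>+h. ennreal (pmf (next_vertex G \<pi>1 \<pi>2 ?h) (x (Suc n))) * indicator {?h} h \<partial>?H)"
    unfolding eq[symmetric] by (simp add: ennreal_pmf_bind)
  also have "\<dots> = ennreal (pmf (next_vertex G \<pi>1 \<pi>2 ?h) (x (Suc n))) * ennreal (pmf ?H ?h)"
    by (simp add: nn_integral_cmult_indicator emeasure_pmf_single del: upt_Suc)
  finally show ?case
    unfolding Suc.IH
    by (auto simp: ennreal_mult'' prod_nonneg indicator_def mult.commute simp del: upt_Suc)
qed

lemma measurable_prefix [measurable]:
  fixes v :: "'v::finite"
  shows "(\<lambda>\<omega>. map \<omega> [0..<n]) \<in> path_measure G \<pi>1 \<pi>2 v \<rightarrow>\<^sub>M count_space UNIV"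
proof -
  let ?P = "path_measure G \<pi>1 \<pi>2 v"
  have "(\<lambda>\<omega>. map \<omega> [0..<n]) -` {xs} \<inter> space ?P \<in> sets ?P" for xs
  proof (cases "length xs = n")
    case True
    have "{\<omega>\<in>space ?P. \<omega> i = a} \<in> sets ?P" for i a by measurable
    then have "{\<omega>\<in>space ?P. \<forall>i\<in>{..<n}. \<omega> i = xs ! i} \<in> sets ?P"
      by (intro sets.sets_Collect_finite_All) auto
    moreover have "map \<omega> [0..<n] = xs \<longleftrightarrow> (\<forall>i\<in>{..<n}. \<omega> i = xs ! i)" for \<omega>
      using True by (subst list_eq_iff_nth_eq) auto
    then have "(\<lambda>\<omega>. map \<omega> [0..<n]) -` {xs} \<inter> space ?P =
       {\<omega>\<in>space ?P. \<forall>i\<in>{..<n}. \<omega> i = xs ! i}"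
      by (simp add: vimage_def)
    ultimately show ?thesis by simp
  next
    case False
    then have "(\<lambda>\<omega>. map \<omega> [0..<n]) -` {xs} \<inter> space ?P = {}" by auto
    then show ?thesis by (simp only: sets.empty_sets)
  qed
  then show ?thesis
    by (simp add: measurable_count_space_eq_countable)
qed

text \<open>There are countably many lists, so singletons decide: for length \<open>Suc n\<close>
  both sides are the cylinder product, for every other length both are zero.\<close>

lemma distr_prefix_path_measure:
  fixes v :: "'v::finite"
  shows "distr (path_measure G \<pi>1 \<pi>2 v) (count_space UNIV) (\<lambda>\<omega>. map \<omega> [0..<Suc n]) =
     measure_pmf (history_pmf G \<pi>1 \<pi>2 v n)" (is "?D = ?H")
proof (rule measure_eqI_countable[where A=UNIV])
  fix xs :: "'v list"
  have D: "emeasure ?D {xs} = emeasure (path_measure G \<pi>1 \<pi>2 v) {\<omega>. map \<omega> [0..<Suc n] = xs}"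
    by (subst emeasure_distr) (auto simp: vimage_def simp del: upt_Suc)
  show "emeasure ?D {xs} = emeasure ?H {xs}"
  proof (cases "length xs = Suc n")
    case True
    have 1: "{\<omega>. map \<omega> [0..<Suc n] = xs} = {\<omega>. \<forall>i\<le>n. \<omega> i = xs ! i}"
      using True by (auto simp: list_eq_iff_nth_eq less_Suc_eq_le simp del: upt_Suc)
    have 2: "xs = map ((!) xs) [0..<Suc n]"
      using True by (metis map_nth)
    show ?thesis
      unfolding D 1 emeasure_path_measure_cylinder emeasure_pmf_single
      using pmf_history_pmf[of G \<pi>1 \<pi>2 v n "(!) xs"] 2[symmetric] by (simp del: upt_Suc)
  next
    case False
    then have "{\<omega>. map \<omega> [0..<Suc n] = xs} = {}" by auto
    moreover have "pmf (history_pmf G \<pi>1 \<pi>2 v n) xs = 0"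
      using False length_history_pmf by (metis pmf_eq_0_set_pmf)
    ultimately show ?thesis unfolding D by (simp add: emeasure_pmf_single)
  qed
qed (auto simp: prob_space.emeasure_le_1 intro!: ennreal_one_less_top)

lemma nn_integral_prefix:
  fixes v :: "'v::finite"
  shows "(\<integral>\<^sup>+\<omega>. F (map \<omega> [0..<Suc n]) \<partial>path_measure G \<pi>1 \<pi>2 v) = (\<integral>\<^sup>+h. F h \<partial>history_pmf G \<pi>1 \<pi>2 v n)"
  unfolding distr_prefix_path_measure[symmetric]
  by (subst nn_integral_distr) (auto simp del: upt_Suc)

text \<open>A supermartingale bound, by integrating the one-step inequality over
  \<open>history_pmf\<close> and iterating. Every history contains the initial vertex, so nonempty
  lists suffice.\<close>

lemma nn_integral_prefix_le:
  fixes v :: "'v::finite" and F :: "'v list \<Rightarrow> ennreal"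
  assumes "\<And>h. h \<noteq> [] \<Longrightarrow> (\<integral>\<^sup>+u. F (h @ [u]) \<partial>next_vertex G \<pi>1 \<pi>2 h) \<le> F h"
  shows "(\<integral>\<^sup>+\<omega>. F (map \<omega> [0..<Suc n]) \<partial>path_measure G \<pi>1 \<pi>2 v) \<le> F [v]"
  unfolding nn_integral_prefix
proof (induction n)
  case (Suc n)
  have "(\<integral>\<^sup>+h. F h \<partial>history_pmf G \<pi>1 \<pi>2 v (Suc n)) =
     (\<integral>\<^sup>+h. (\<integral>\<^sup>+u. F (h @ [u]) \<partial>next_vertex G \<pi>1 \<pi>2 h) \<partial>history_pmf G \<pi>1 \<pi>2 v n)"
    by simp
  also have "\<dots> \<le> (\<integral>\<^sup>+h. F h \<partial>history_pmf G \<pi>1 \<pi>2 v n)"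
    by (intro nn_integral_mono_AE AE_pmfI assms) (auto dest: length_history_pmf)
  finally show ?case using Suc.IH by (rule order_trans)
qed simp

text \<open>The submartingale counterpart of \<open>nn_integral_prefix_le\<close>.\<close>

lemma nn_integral_prefix_ge:
  fixes v :: "'v::finite" and F :: "'v list \<Rightarrow> ennreal"
  assumes "\<And>h. h \<noteq> [] \<Longrightarrow> F h \<le> (\<integral>\<^sup>+u. F (h @ [u]) \<partial>next_vertex G \<pi>1 \<pi>2 h)"
  shows "F [v] \<le> (\<integral>\<^sup>+\<omega>. F (map \<omega> [0..<Suc n]) \<partial>path_measure G \<pi>1 \<pi>2 v)"
  unfolding nn_integral_prefix
proof (induction n)
  case (Suc n)
  have "(\<integral>\<^sup>+h. F h \<partial>history_pmf G \<pi>1 \<pi>2 v n) \<le>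
      (\<integral>\<^sup>+h. (\<integral>\<^sup>+u. F (h @ [u]) \<partial>next_vertex G \<pi>1 \<pi>2 h) \<partial>history_pmf G \<pi>1 \<pi>2 v n)"
    by (intro nn_integral_mono_AE AE_pmfI assms) (auto dest: length_history_pmf)
  also have "\<dots> = (\<integral>\<^sup>+h. F h \<partial>history_pmf G \<pi>1 \<pi>2 v (Suc n))"
    by simp
  finally show ?case using Suc.IH by (rule order_trans[rotated])
qed simp

section \<open>Almost sure properties of plays\<close>

lemma set_pmf_next_vertex:
  assumes "stochastic_game G" "strategy G (V1 G) \<pi>1" "strategy G (V2 G) \<pi>2" "h \<noteq> []"
  shows "set_pmf (next_vertex G \<pi>1 \<pi>2 h) \<subseteq> post G (last h)"
proof -
  have *: "set_pmf (\<pi> h) \<subseteq> post G (last h)" if "strategy G U \<pi>" "last h \<in> U" for \<pi> U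
    using that assms(4) unfolding strategy_def
    by (metis append_butlast_last_id pmf_positive_iff subsetI)
  show ?thesis
  proof (cases "last h \<in> VP G")
    case True
    then show ?thesis
      using pmf_next_vertex_VP[OF assms(1) True] by (auto simp: set_pmf_iff post_def)
        (use assms(1) in \<open>auto simp: stochastic_game_def order_less_le\<close>)
  next
    case False
    then have "last h \<in> V1 G \<or> last h \<in> V2 G"
      using assms(1) by (auto simp: stochastic_game_def)
    then show ?thesis
      using *[OF assms(2)] *[OF assms(3)] assms(1) by (auto simp: next_vertex_def)
  qed
qed

text \<open>A nonnegative supermartingale that starts at \<open>0\<close> has expectation
  \<open>0\<close> at every time. With \<open>F\<close> the indicator of a bad history, it shows
  that bad histories almost surely never arise.\<close>

lemma AE_prefix_zero:
  fixes v :: "'v::finite" and F :: "'v list \<Rightarrow> ennreal"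
  assumes "\<And>h. h \<noteq> [] \<Longrightarrow> (\<integral>\<^sup>+u. F (h @ [u]) \<partial>next_vertex G \<pi>1 \<pi>2 h) \<le> F h" and "F [v] = 0"
  shows "AE \<omega> in path_measure G \<pi>1 \<pi>2 v. \<forall>n. F (map \<omega> [0..<Suc n]) = 0"
  unfolding AE_all_countable
proof
  fix n
  have "(\<integral>\<^sup>+\<omega>. F (map \<omega> [0..<Suc n]) \<partial>path_measure G \<pi>1 \<pi>2 v) = 0"
    using nn_integral_prefix_le[OF assms(1), where v=v and n=n] assms(2) by simp
  then show "AE \<omega> in path_measure G \<pi>1 \<pi>2 v. F (map \<omega> [0..<Suc n]) = 0"
    by (subst (asm) nn_integral_0_iff_AE) (auto simp del: upt_Suc)
qed

lemma AE_is_path: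
  fixes v :: "'v::finite"
  assumes "stochastic_game G" "strategy G (V1 G) \<pi>1" "strategy G (V2 G) \<pi>2"
  shows "AE \<omega> in path_measure G \<pi>1 \<pi>2 v. is_path G \<omega>"
proof -
  \<comment> \<open>\<open>F\<close> flags histories that already contain a step outside
    \<open>post\<close>. A legal move never raises it, and \<open>[v]\<close> is not
    flagged.\<close>
  define F :: "'v list \<Rightarrow> ennreal" where
    "F h = of_bool (\<exists>i. Suc i < length h \<and> h ! Suc i \<notin> post G (h ! i))" for h
  have "AE \<omega> in path_measure G \<pi>1 \<pi>2 v. \<forall>n. F (map \<omega> [0..<Suc n]) = 0"
  proof (rule AE_prefix_zero)
    fix h :: "'v list" assume h: "h \<noteq> []"
    have "F (h @ [u]) \<le> F h" if u: "u \<in> post G (last h)" for u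
    proof -
      obtain m where "length h = Suc m" using h by (cases h) auto
      then have False if "Suc i < length (h @ [u])" "(h @ [u]) ! Suc i \<notin> post G ((h @ [u]) ! i)"
        "\<not> (\<exists>i. Suc i < length h \<and> h ! Suc i \<notin> post G (h ! i))" for i
        using that u h by (auto simp: nth_append last_conv_nth less_Suc_eq split: if_splits)
      then show ?thesis unfolding F_def of_bool_def by (auto split: if_splits)
    qed
    then have "(\<integral>\<^sup>+u. F (h @ [u]) \<partial>next_vertex G \<pi>1 \<pi>2 h) \<le> (\<integral>\<^sup>+u. F h \<partial>next_vertex G \<pi>1 \<pi>2 h)"
      using set_pmf_next_vertex[OF assms h] by (intro nn_integral_mono_AE AE_pmfI) auto
    then show "(\<integral>\<^sup>+u. F (h @ [u]) \<partial>next_vertex G \<pi>1 \<pi>2 h) \<le> F h" by simp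
  qed (simp add: F_def)
  then show ?thesis
  proof (rule AE_mp, intro AE_I2 impI)
    fix \<omega> assume *: "\<forall>n. F (map \<omega> [0..<Suc n]) = 0"
    have "\<omega> (Suc k) \<in> post G (\<omega> k)" for k
      using *[rule_format, of "Suc k"]
      by (auto simp: F_def simp del: upt_Suc dest!: spec[of _ k])
    then show "is_path G \<omega>" by (simp add: is_path_def post_def)
  qed
qed

subsection \<open>Memoryless strategies with full support are fair\<close>

text \<open>
  The product over the steps of a history in which every step from \<open>u\<close> contributes \<open>0\<close> if it leads
  to \<open>u'\<close> and \<open>1 / (1 - p) > 1\<close> otherwise has expectation at most \<open>1\<close>, yet it tends to infinity
  along every path that visits \<open>u\<close> infinitely often and eventually never moves on to \<open>u'\<close>.
\<close>

lemma AE_infinitely_often_step: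
  fixes v :: "'v::finite"
  assumes p: "0 < p" "p < 1"
    and step: "\<And>h. h \<noteq> [] \<Longrightarrow> last h = u \<Longrightarrow> p \<le> pmf (next_vertex G \<pi>1 \<pi>2 h) u'"
  shows "AE \<omega> in path_measure G \<pi>1 \<pi>2 v. u \<in> inf_vertices \<omega> \<longrightarrow> (\<exists>\<^sub>\<infinity>k. \<omega> k = u \<and> \<omega> (Suc k) = u')"
proof -
  let ?P = "path_measure G \<pi>1 \<pi>2 v"
  \<comment> \<open>\<open>q\<close> is chosen so that a factor \<open>q\<close> with probability
    \<open>1 - p\<close> and \<open>0\<close> otherwise has mean exactly \<open>1\<close>.\<close>
  define q where "q = 1 / (1 - p)"
  have q: "q > 1" "q * (1 - p) = 1" using p by (auto simp: q_def field_simps)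
  define c :: "'v \<Rightarrow> 'v \<Rightarrow> ennreal" where
    "c a b = (if a = u then if b = u' then 0 else ennreal q else 1)" for a b
  have c_int: "(\<integral>\<^sup>+x. c (last h) x \<partial>next_vertex G \<pi>1 \<pi>2 h) \<le> 1" if "h \<noteq> []" for h
  proof (cases "last h = u")
    case True
    have "(\<integral>\<^sup>+x. c (last h) x \<partial>next_vertex G \<pi>1 \<pi>2 h) =
        (\<integral>\<^sup>+x. ennreal q * indicator (- {u'}) x \<partial>next_vertex G \<pi>1 \<pi>2 h)"
      using True by (intro nn_integral_cong) (auto simp: c_def)
    also have "\<dots> = ennreal q * ennreal (1 - pmf (next_vertex G \<pi>1 \<pi>2 h) u')"
      using measure_pmf.prob_compl[of "{u'}" "next_vertex G \<pi>1 \<pi>2 h"]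
      by (simp add: nn_integral_cmult_indicator measure_pmf.emeasure_eq_measure
            Compl_eq_Diff_UNIV measure_pmf_single)
    also have "\<dots> \<le> ennreal q * ennreal (1 - p)"
      using step[OF that True] by (intro mult_left_mono ennreal_leI) auto
    also have "\<dots> = 1" using q p by (simp add: ennreal_mult'[symmetric])
    finally show ?thesis .
  qed (simp add: c_def)
  \<comment> \<open>\<open>N\<close> is a time from which on the step from \<open>u\<close> to
    \<open>u'\<close> no longer occurs; the union over all \<open>N\<close> is taken at the
    end.\<close>
  have null: "AE \<omega> in ?P. \<not> (u \<in> inf_vertices \<omega> \<and> (\<forall>i\<ge>N. \<not> (\<omega> i = u \<and> \<omega> (Suc i) = u')))" for N
  proof -
    \<comment> \<open>Factors before time \<open>N\<close> are left out, since an early step from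
      \<open>u\<close> to \<open>u'\<close> would make the whole product vanish. A nonempty
      \<open>h\<close> has \<open>length h - 1\<close> steps.\<close>
    define F where "F h = (\<Prod>i\<in>{N..<length h - 1}. c (h ! i) (h ! Suc i))" for h
    define W where "W n \<omega> = (\<Prod>i\<in>{N..<n}. c (\<omega> i) (\<omega> (Suc i)))" for n and \<omega> :: "nat \<Rightarrow> 'v"
    have W_F: "W n \<omega> = F (map \<omega> [0..<Suc n])" for n \<omega>
      unfolding F_def W_def by (intro prod.cong) (auto simp del: upt_Suc)
    have W_meas [measurable]: "W n \<in> borel_measurable ?P" for n
      unfolding W_F[abs_def] by measurable
    have "(\<integral>\<^sup>+\<omega>. W n \<omega> \<partial>?P) \<le> F [v]" for n
      unfolding W_F
    proof (rule nn_integral_prefix_le)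
      fix h :: "'v list" assume h: "h \<noteq> []"
      show "(\<integral>\<^sup>+x. F (h @ [x]) \<partial>next_vertex G \<pi>1 \<pi>2 h) \<le> F h"
      proof (cases "N < length h")
        case True
        have F: "F (h @ [x]) = F h * c (last h) x" for x
        proof -
          have "{N..<length (h @ [x]) - 1} = insert (length h - 1) {N..<length h - 1}"
            using h True by auto
          then show ?thesis
            using h by (simp add: F_def nth_append last_conv_nth mult.commute)
              (intro arg_cong2[where f="(*)"] prod.cong; auto)
        qed
        have "(\<integral>\<^sup>+x. F (h @ [x]) \<partial>next_vertex G \<pi>1 \<pi>2 h) =
            F h * (\<integral>\<^sup>+x. c (last h) x \<partial>next_vertex G \<pi>1 \<pi>2 h)"
          unfolding F by (rule nn_integral_cmult) simp
        also have "\<dots> \<le> F h * 1" by (intro mult_left_mono c_int h) simp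
        finally show ?thesis by simp
      qed (simp add: F_def)
    qed
    then have "(\<integral>\<^sup>+\<omega>. W n \<omega> \<partial>?P) \<le> 1" for n by (simp add: F_def)
    \<comment> \<open>Fatou's lemma carries the bound to the pointwise \<open>liminf\<close>, which
      is thus finite almost everywhere.\<close>
    then have "liminf (\<lambda>n. \<integral>\<^sup>+\<omega>. W n \<omega> \<partial>?P) \<le> 1"
      by (intro Liminf_le) auto
    then have "(\<integral>\<^sup>+\<omega>. liminf (\<lambda>n. W n \<omega>) \<partial>?P) \<le> 1"
      by (rule order_trans[OF nn_integral_liminf, rotated]) measurable
    then have "(\<integral>\<^sup>+\<omega>. liminf (\<lambda>n. W n \<omega>) \<partial>?P) \<noteq> \<infinity>"
      by (auto simp: top_unique)
    then have "AE \<omega> in ?P. liminf (\<lambda>n. W n \<omega>) \<noteq> \<infinity>"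
      by (intro nn_integral_noteq_infinite) measurable
    then show ?thesis
    proof (rule AE_mp, intro AE_I2 impI notI, elim conjE)
      fix \<omega> assume fin: "liminf (\<lambda>n. W n \<omega>) \<noteq> \<infinity>"
        and io: "u \<in> inf_vertices \<omega>" and never: "\<forall>i\<ge>N. \<not> (\<omega> i = u \<and> \<omega> (Suc i) = u')"
      \<comment> \<open>On such a path no factor is \<open>0\<close>, so \<open>W n\<close> has the
        number of visits to \<open>u\<close> as exponent of \<open>q\<close>.\<close>
      have W: "W n \<omega> = ennreal q ^ card {i\<in>{N..<n}. \<omega> i = u}" for n
      proof -
        have "W n \<omega> = (\<Prod>i\<in>{N..<n}. if \<omega> i = u then ennreal q else 1)"
          unfolding W_def using never by (intro prod.cong) (auto simp: c_def)
        also have "\<dots> = (\<Prod>i\<in>{i\<in>{N..<n}. \<omega> i = u}. ennreal q)"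
          by (subst prod.inter_filter) auto
        finally show ?thesis by simp
      qed
      have ge: "ennreal (q ^ k) \<le> liminf (\<lambda>n. W n \<omega>)" for k
      proof (rule Liminf_bounded)
        have "infinite {i. \<omega> i = u}" using io by (simp add: inf_vertices_def INFM_iff_infinite)
        then have "infinite ({i. \<omega> i = u} - {..<N})" by simp
        then obtain B where B: "B \<subseteq> {i. \<omega> i = u} - {..<N}" "card B = k" "finite B"
          using infinite_arbitrarily_large by blast
        show "\<forall>\<^sub>F n in sequentially. ennreal (q ^ k) \<le> W n \<omega>"
        proof (rule eventually_sequentiallyI)
          fix n assume n: "Suc (Max (insert 0 B)) \<le> n"
          have "B \<subseteq> {i\<in>{N..<n}. \<omega> i = u}"
          proof
            fix i assume i: "i \<in> B"
            then have "i \<le> Max (insert 0 B)" using B(3) by simp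
            then show "i \<in> {i\<in>{N..<n}. \<omega> i = u}" using n B(1) i by auto
          qed
          then have "k \<le> card {i\<in>{N..<n}. \<omega> i = u}"
            using card_mono[of "{i\<in>{N..<n}. \<omega> i = u}" B] B(2) by simp
          then have "q ^ k \<le> q ^ card {i\<in>{N..<n}. \<omega> i = u}"
            using q by (intro power_increasing) auto
          then show "ennreal (q ^ k) \<le> W n \<omega>"
            unfolding W using q by (simp add: ennreal_power ennreal_leI)
        qed
      qed
      obtain x where x: "liminf (\<lambda>n. W n \<omega>) = ennreal x" "0 \<le> x"
        using fin by (cases "liminf (\<lambda>n. W n \<omega>)") auto
      obtain k where "x < q ^ k" using real_arch_pow[OF q(1)] by blast
      then show False using ge[of k] x by simp
    qed
  qed
  have "AE \<omega> in ?P. \<forall>N. \<not> (u \<in> inf_vertices \<omega> \<and> (\<forall>i\<ge>N. \<not> (\<omega> i = u \<and> \<omega> (Suc i) = u')))"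
    unfolding AE_all_countable using null by blast
  then show ?thesis
    by eventually_elim (auto simp: INFM_nat_le)
qed

text \<open>If a Player 2 vertex is visited infinitely often, each of its edges is almost surely
  taken infinitely often, because the edge has probability at least the fixed \<open>p\<close> after
  every history.\<close>

lemma fair_strategyI:
  fixes G :: "('v::finite) game"
  assumes G: "stochastic_game G" and st: "strategy G (V2 G) \<pi>2"
    and p: "0 < p" and full: "\<And>w u u'. u \<in> V2 G \<Longrightarrow> u' \<in> post G u \<Longrightarrow> p \<le> pmf (\<pi>2 (w @ [u])) u'"
  shows "fair_strategy G \<pi>2"
  unfolding fair_strategy_def
proof (intro conjI st allI impI)
  fix \<pi>1 v assume st1: "strategy G (V1 G) \<pi>1"
  let ?P = "path_measure G \<pi>1 \<pi>2 v"
  interpret prob_space ?P by (rule prob_space_path_measure)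
  have "AE \<omega> in ?P. u' \<in> post G u \<longrightarrow> u \<in> V2 G \<longrightarrow> u \<in> inf_vertices \<omega> \<longrightarrow> u' \<in> inf_vertices \<omega>"
    for u u'
  proof (cases "u \<in> V2 G \<and> u' \<in> post G u")
    case True
    have "AE \<omega> in ?P. u \<in> inf_vertices \<omega> \<longrightarrow> (\<exists>\<^sub>\<infinity>k. \<omega> k = u \<and> \<omega> (Suc k) = u')"
    proof (rule AE_infinitely_often_step)
      \<comment> \<open>\<open>AE_infinitely_often_step\<close> asks for a bound strictly below
        \<open>1\<close>, while \<open>p\<close> may be \<open>1\<close>.\<close>
      show "0 < min p (1 / 2)" "min p (1 / 2) < 1" using p by auto
      fix h :: "'v list" assume h: "h \<noteq> []" "last h = u"
      then have "next_vertex G \<pi>1 \<pi>2 h = \<pi>2 (butlast h @ [u])"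
        using True G by (auto simp: next_vertex_def stochastic_game_def)
      then show "min p (1 / 2) \<le> pmf (next_vertex G \<pi>1 \<pi>2 h) u'"
        using full[of u u' "butlast h"] True by simp
    qed
    then show ?thesis
    proof (rule AE_mp, intro AE_I2 impI)
      fix \<omega> assume "u \<in> inf_vertices \<omega> \<longrightarrow> (\<exists>\<^sub>\<infinity>k. \<omega> k = u \<and> \<omega> (Suc k) = u')" "u \<in> inf_vertices \<omega>"
      then have *: "\<exists>\<^sub>\<infinity>k. \<omega> k = u \<and> \<omega> (Suc k) = u'" by simp
      show "u' \<in> inf_vertices \<omega>"
        unfolding inf_vertices_def mem_Collect_eq INFM_nat
      proof
        fix m
        obtain n where "m < n" "\<omega> (Suc n) = u'" using * unfolding INFM_nat by blast
        then show "\<exists>n>m. \<omega> n = u'" by (intro exI[of _ "Suc n"]) simp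
      qed
    qed
  qed auto
  then have "AE \<omega> in ?P. \<forall>u u'. u' \<in> post G u \<longrightarrow> u \<in> V2 G \<longrightarrow> u \<in> inf_vertices \<omega> \<longrightarrow> u' \<in> inf_vertices \<omega>"
    by (simp add: AE_all_countable)
  with AE_is_path[OF G st1 st, of v] have "AE \<omega> in ?P. \<omega> \<in> fair_plays G"
    by eventually_elim (auto simp: fair_plays_def)
  then show "prob (fair_plays G) = 1" by (simp add: prob_eq_1)
qed

section \<open>Successor sets and positional strategies\<close>

lemma pmf_embed_pmf_delta:
  assumes "stochastic_game G" "u \<in> VP G"
  shows "pmf (embed_pmf (delta G u)) u' = delta G u u'"
proof -
  have "u \<notin> V1 G" "u \<notin> V2 G" using assms by (auto simp: stochastic_game_def)
  then show ?thesis
    using pmf_next_vertex_VP[OF assms(1), of "[u]"] assms(2) by (simp add: next_vertex_def)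
qed

lemma set_pmf_embed_pmf_delta:
  assumes "stochastic_game G" "u \<in> VP G"
  shows "set_pmf (embed_pmf (delta G u)) = post G u"
  using assms pmf_embed_pmf_delta[OF assms]
  by (auto simp: set_pmf_eq post_def stochastic_game_def order_less_le)

lemma post_nonempty: "stochastic_game G \<Longrightarrow> post G u \<noteq> {}"
  by (simp add: stochastic_game_def)

lemma post_terminal: "terminal G u \<Longrightarrow> post G u = {u}"
  by (force simp: terminal_def post_def)

lemma vertex_cases:
  assumes "stochastic_game G"
  obtains "u \<in> V1 G" "u \<notin> V2 G" "u \<notin> VP G" | "u \<in> V2 G" "u \<notin> V1 G" "u \<notin> VP G"
    | "u \<in> VP G" "u \<notin> V1 G" "u \<notin> V2 G"
  using assms by (auto simp: stochastic_game_def)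

lemma memoryless_last: "memoryless U (\<lambda>h. f (last h))"
  by (simp add: memoryless_def)

lemma strategy_lastI:
  "(\<And>u. u \<in> U \<Longrightarrow> set_pmf (f u) \<subseteq> post G u) \<Longrightarrow> strategy G U (\<lambda>h. f (last h))"
  by (auto simp: strategy_def pmf_positive_iff)

subsection \<open>Bellman inequalities and expected rewards\<close>

text \<open>
  The Bellman operator of the game in which Player 2 has to mix the uniform distribution over the
  successors, with weight \<open>l\<close>, into every choice.
\<close>

definition bellman :: "('v::finite) game \<Rightarrow> ('v \<Rightarrow> real) \<Rightarrow> real \<Rightarrow> ('v \<Rightarrow> ennreal) \<Rightarrow> 'v \<Rightarrow> ennreal" where
  "bellman G r l f u = ennreal (r u) +
     (if u \<in> V1 G then (SUP u'\<in>post G u. f u')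
      else if u \<in> V2 G then ennreal (1 - l) * (INF u'\<in>post G u. f u') +
        ennreal l * (\<integral>\<^sup>+u'. f u' \<partial>pmf_of_set (post G u))
      else \<integral>\<^sup>+u'. f u' \<partial>embed_pmf (delta G u))"

lemma bellman_mono: "f \<le> g \<Longrightarrow> bellman G r l f \<le> bellman G r l g"
  unfolding bellman_def le_fun_def
  by (auto intro!: add_left_mono add_mono mult_left_mono SUP_mono' INF_mono' nn_integral_mono)

lemma nn_integral_pmf_ge_INF:
  assumes "set_pmf M \<subseteq> A"
  shows "(INF x\<in>A. f x) \<le> (\<integral>\<^sup>+x. (f x :: ennreal) \<partial>measure_pmf M)"
proof -
  have "(INF x\<in>A. f x) = (\<integral>\<^sup>+x. (INF x\<in>A. f x) \<partial>measure_pmf M)" by simp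
  also have "\<dots> \<le> (\<integral>\<^sup>+x. f x \<partial>measure_pmf M)"
    using assms by (intro nn_integral_mono_AE AE_pmfI INF_lower) auto
  finally show ?thesis .
qed

lemma nn_integral_pmf_le_SUP:
  assumes "set_pmf M \<subseteq> A"
  shows "(\<integral>\<^sup>+x. (f x :: ennreal) \<partial>measure_pmf M) \<le> (SUP x\<in>A. f x)"
proof -
  have "(\<integral>\<^sup>+x. f x \<partial>measure_pmf M) \<le> (\<integral>\<^sup>+x. (SUP x\<in>A. f x) \<partial>measure_pmf M)"
    using assms by (intro nn_integral_mono_AE AE_pmfI SUP_upper) auto
  then show ?thesis by simp
qed

text \<open>The mean over the successors is at least their minimum, so moving weight
  \<open>l' - l\<close> from the minimum to the mean can only increase the value.\<close>

lemma bellman_mono_param: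
  assumes "stochastic_game G" "0 \<le> l" "l \<le> l'" "l' \<le> 1"
  shows "bellman G r l f \<le> bellman G r l' f"
proof (rule le_funI)
  fix u
  let ?m = "INF u'\<in>post G u. f u'" and ?a = "\<integral>\<^sup>+u'. f u' \<partial>pmf_of_set (post G u)"
  have le: "?m \<le> ?a"
    using post_nonempty[OF assms(1)] by (intro nn_integral_pmf_ge_INF) simp
  have "ennreal (1 - l) * ?m + ennreal l * ?a =
      ennreal (1 - l') * ?m + ennreal (l' - l) * ?m + ennreal l * ?a"
    using assms by (simp flip: distrib_right ennreal_plus)
  also have "\<dots> \<le> ennreal (1 - l') * ?m + ennreal (l' - l) * ?a + ennreal l * ?a"
    by (intro add_mono mult_left_mono le order_refl) auto
  also have "\<dots> = ennreal (1 - l') * ?m + ennreal l' * ?a"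
    using assms by (simp add: add.assoc flip: distrib_right ennreal_plus)
  finally show "bellman G r l f u \<le> bellman G r l' f u"
    unfolding bellman_def by (auto intro!: add_left_mono)
qed

section \<open>Bounds on the total reward from one-step inequalities\<close>

definition partial_reward :: "('v \<Rightarrow> real) \<Rightarrow> 'v list \<Rightarrow> ennreal" where
  "partial_reward r h = sum_list (map (\<lambda>u. ennreal (r u)) (butlast h))"

lemma partial_reward_snoc:
  "h \<noteq> [] \<Longrightarrow> partial_reward r (h @ [u]) = partial_reward r h + ennreal (r (last h))"
  by (cases h rule: rev_cases) (auto simp: partial_reward_def butlast_append)

lemma partial_reward_prefix:
  "partial_reward r (map \<omega> [0..<Suc n]) = (\<Sum>i<n. ennreal (r (\<omega> i)))"
  unfolding partial_reward_def by (simp add: interv_sum_list_conv_sum_set_nat atLeast0LessThan)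

text \<open>\<open>partial_reward\<close> leaves out the last vertex, whose reward belongs to the
  future measured by \<open>f\<close>. Hence a Bellman inequality for \<open>f\<close> makes the sum
  a super- or submartingale.\<close>

lemma nn_integral_partial_reward_snoc:
  fixes f :: "'v \<Rightarrow> ennreal"
  assumes "h \<noteq> []"
  shows "(\<integral>\<^sup>+u. partial_reward r (h @ [u]) + f (last (h @ [u])) \<partial>measure_pmf M) =
     partial_reward r h + (ennreal (r (last h)) + (\<integral>\<^sup>+u. f u \<partial>measure_pmf M))"
  using assms by (simp add: partial_reward_snoc nn_integral_add add.assoc)

text \<open>By the one-step inequality \<open>partial_reward r h + f (last h)\<close> is a
  supermartingale. Dropping its second summand bounds every partial sum of expected rewards by
  \<open>f v\<close>.\<close>

lemma expected_reward_le:
  assumes "\<And>h. h \<noteq> [] \<Longrightarrow> ennreal (r (last h)) + (\<integral>\<^sup>+u. f u \<partial>next_vertex G \<pi>1 \<pi>2 h) \<le> f (last h)"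
  shows "expected_reward G r \<pi>1 \<pi>2 v \<le> f v"
proof -
  let ?P = "path_measure G \<pi>1 \<pi>2 v"
  have *: "(\<Sum>i<n. \<integral>\<^sup>+\<omega>. ennreal (r (\<omega> i)) \<partial>?P) \<le> f v" for n
  proof -
    have "(\<Sum>i<n. \<integral>\<^sup>+\<omega>. ennreal (r (\<omega> i)) \<partial>?P) = (\<integral>\<^sup>+\<omega>. (\<Sum>i<n. ennreal (r (\<omega> i))) \<partial>?P)"
      by (rule nn_integral_sum[symmetric]) measurable
    also have "\<dots> \<le> (\<integral>\<^sup>+\<omega>. partial_reward r (map \<omega> [0..<Suc n]) + f (last (map \<omega> [0..<Suc n])) \<partial>?P)"
      unfolding partial_reward_prefix by (intro nn_integral_mono) simp
    also have "\<dots> \<le> partial_reward r [v] + f (last [v])"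
      by (rule nn_integral_prefix_le[where F="\<lambda>h. partial_reward r h + f (last h)"],
          unfold nn_integral_partial_reward_snoc)
        (intro add_left_mono assms)
    finally show ?thesis by (simp add: partial_reward_def)
  qed
  have "expected_reward G r \<pi>1 \<pi>2 v = (\<Sum>i. \<integral>\<^sup>+\<omega>. ennreal (r (\<omega> i)) \<partial>?P)"
    unfolding expected_reward_def total_reward_def by (rule nn_integral_suminf) measurable
  also have "\<dots> \<le> f v" by (intro suminf_le_const * summableI)
  finally show ?thesis .
qed

text \<open>The same sum is now a submartingale. Its reward part is at most the total reward, and
  the remaining part \<open>f (\<omega> n)\<close> has vanishing expectation because terminal
  vertices are reached almost surely and are absorbing.\<close>

lemma expected_reward_ge:
  fixes f :: "'v::finite \<Rightarrow> ennreal"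
  assumes sub: "\<And>h. h \<noteq> [] \<Longrightarrow> f (last h) \<le> ennreal (r (last h)) + (\<integral>\<^sup>+u. f u \<partial>next_vertex G \<pi>1 \<pi>2 h)"
    and fin: "\<And>u. f u \<noteq> \<top>" and terminal_zero: "\<And>u. terminal G u \<Longrightarrow> f u = 0"
    and stop: "measure (path_measure G \<pi>1 \<pi>2 v) (reach_terminal G) = 1"
  shows "f v \<le> expected_reward G r \<pi>1 \<pi>2 v"
proof -
  let ?P = "path_measure G \<pi>1 \<pi>2 v"
  interpret prob_space ?P by (rule prob_space_path_measure)
  have reach: "AE \<omega> in ?P. \<omega> \<in> reach_terminal G" using stop by (simp add: prob_eq_1)
  have conv: "AE \<omega> in ?P. (\<lambda>n. f (\<omega> n)) \<longlonglongrightarrow> 0"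
    using reach
  proof eventually_elim
    fix \<omega> assume "\<omega> \<in> reach_terminal G"
    then obtain k where k: "terminal G (\<omega> k)" and path: "is_path G \<omega>"
      by (auto simp: reach_terminal_def)
    have "\<omega> (k + n) = \<omega> k" for n
    proof (induction n)
      case (Suc n)
      have "\<omega> (Suc (k + n)) \<in> post G (\<omega> (k + n))" using path by (simp add: is_path_def post_def)
      then show ?case using post_terminal[OF k] Suc by simp
    qed simp
    then have "f (\<omega> n) = 0" if "n \<ge> k" for n
      using that terminal_zero[OF k] by (metis le_add_diff_inverse)
    then show "(\<lambda>n. f (\<omega> n)) \<longlonglongrightarrow> 0"
      by (intro tendsto_eventually eventually_sequentiallyI)
  qed
  \<comment> \<open>Finitely many vertices with finite values give a constant majorant.\<close>
  have "(\<lambda>n. \<integral>\<^sup>+\<omega>. f (\<omega> n) \<partial>?P) \<longlonglongrightarrow> (\<integral>\<^sup>+\<omega>. 0 \<partial>?P)"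
  proof (rule nn_integral_dominated_convergence[where w="\<lambda>_. \<Sum>u\<in>UNIV. f u"])
    show "(\<integral>\<^sup>+\<omega>. (\<Sum>u\<in>UNIV. f u) \<partial>?P) < \<infinity>"
      using fin emeasure_space_1 by (simp add: less_top)
    show "AE \<omega> in ?P. f (\<omega> n) \<le> (\<Sum>u\<in>UNIV. f u)" for n
      by (intro AE_I2 member_le_sum) auto
  qed (use conv in \<open>auto\<close>)
  then have lim: "(\<lambda>n. expected_reward G r \<pi>1 \<pi>2 v + (\<integral>\<^sup>+\<omega>. f (\<omega> n) \<partial>?P)) \<longlonglongrightarrow> expected_reward G r \<pi>1 \<pi>2 v + 0"
    by (intro tendsto_add tendsto_const) simp
  have "f v \<le> expected_reward G r \<pi>1 \<pi>2 v + (\<integral>\<^sup>+\<omega>. f (\<omega> n) \<partial>?P)" for n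
  proof -
    have "partial_reward r [v] + f (last [v]) \<le>
        (\<integral>\<^sup>+\<omega>. partial_reward r (map \<omega> [0..<Suc n]) + f (last (map \<omega> [0..<Suc n])) \<partial>?P)"
      by (rule nn_integral_prefix_ge[where F="\<lambda>h. partial_reward r h + f (last h)"],
          unfold nn_integral_partial_reward_snoc)
        (intro add_left_mono sub)
    also have "\<dots> = (\<integral>\<^sup>+\<omega>. (\<Sum>i<n. ennreal (r (\<omega> i))) + f (\<omega> n) \<partial>?P)"
      unfolding partial_reward_prefix by simp
    also have "\<dots> \<le> (\<integral>\<^sup>+\<omega>. total_reward r \<omega> + f (\<omega> n) \<partial>?P)"
      unfolding total_reward_def by (intro nn_integral_mono add_right_mono sum_le_suminf) auto
    also have "\<dots> = expected_reward G r \<pi>1 \<pi>2 v + (\<integral>\<^sup>+\<omega>. f (\<omega> n) \<partial>?P)"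
      unfolding expected_reward_def by (intro nn_integral_add) measurable
    finally show ?thesis by (simp add: partial_reward_def)
  qed
  then show ?thesis
    using LIMSEQ_le_const[OF lim, of "f v"] by auto
qed

text \<open>For \<open>0 < l \<le> 1\<close> every successor gets positive probability, which
  fairness rests on; \<open>l = 1\<close> is the uniform choice.\<close>

definition perturbed_choice :: "('v::finite) game \<Rightarrow> real \<Rightarrow> ('v \<Rightarrow> 'v) \<Rightarrow> 'v strategy" where
  "perturbed_choice G l \<sigma> h =
     bind_pmf (bernoulli_pmf l)
       (\<lambda>b. if b then pmf_of_set (post G (last h)) else return_pmf (\<sigma> (last h)))"

text \<open>The number of successors is at most \<open>card UNIV\<close>, which yields one bound for
  all vertices and histories, as \<open>fair_strategyI\<close> requires.\<close>

lemma pmf_perturbed_choice_ge: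
  assumes "stochastic_game G" "0 < l" "l \<le> 1" "u' \<in> post G u"
  shows "l / card (UNIV :: 'v set) \<le> pmf (perturbed_choice G l \<sigma> (w @ [u])) (u' :: 'v::finite)"
proof -
  have "l / card (UNIV :: 'v set) \<le> l / card (post G u)"
    using assms by (intro divide_left_mono) (auto simp: card_mono card_gt_0_iff intro!: mult_pos_pos)
  also have "\<dots> \<le> pmf (perturbed_choice G l \<sigma> (w @ [u])) u'"
    using assms post_nonempty[of G u]
    by (auto simp: perturbed_choice_def pmf_bind integral_bernoulli_pmf indicator_def)
  finally show ?thesis .
qed

lemma perturbed_choice_memoryless_fair:
  assumes G: "stochastic_game G" and l: "0 < l" "l \<le> 1" and \<sigma>: "\<And>u. \<sigma> u \<in> post G u"
  shows "perturbed_choice G l \<sigma> \<in> memoryless_fair_strategies2 G"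
proof -
  have "strategy G (V2 G) (perturbed_choice G l \<sigma>)"
    unfolding perturbed_choice_def[abs_def]
    by (rule strategy_lastI) (use \<sigma> post_nonempty[OF G] in \<open>auto split: if_splits\<close>)
  moreover have "fair_strategy G (perturbed_choice G l \<sigma>)"
    by (rule fair_strategyI[OF G calculation, of "l / CARD('a)"])
      (use pmf_perturbed_choice_ge[OF G l] l in auto)
  moreover have "memoryless (V2 G) (perturbed_choice G l \<sigma>)"
    unfolding perturbed_choice_def[abs_def] by (rule memoryless_last)
  ultimately show ?thesis
    by (simp add: memoryless_fair_strategies2_def)
qed

section \<open>Strategies read off from sub- and supersolutions\<close>

lemma finite_INF_attained:
  fixes f :: "'a \<Rightarrow> 'b::complete_linorder"
  assumes "finite A" "A \<noteq> {}"
  obtains x where "x \<in> A" "f x = (INF x\<in>A. f x)"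
  using Min_in[of "f ` A"] assms by (auto simp: cInf_eq_Min image_iff) metis

lemma finite_SUP_attained:
  fixes f :: "'a \<Rightarrow> 'b::complete_linorder"
  assumes "finite A" "A \<noteq> {}"
  obtains x where "x \<in> A" "f x = (SUP x\<in>A. f x)"
  using Max_in[of "f ` A"] assms by (auto simp: cSup_eq_Max image_iff) metis

text \<open>Choosing a minimizer of \<open>g\<close> with weight \<open>1 - l\<close> and a uniform
  successor with weight \<open>l\<close> realizes the Player 2 case of \<open>bellman\<close>.
  Player 1 cannot exceed the supremum over successors, so \<open>expected_reward_le\<close> applies
  with one \<open>\<pi>2\<close> for all \<open>\<pi>1\<close> and \<open>v\<close>.\<close>

lemma bellman_supersolution_guarantee:
  assumes G: "stochastic_game G" and l: "0 < l" "l \<le> 1" and super: "bellman G r l g \<le> g"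
  obtains \<pi>2 where "\<pi>2 \<in> memoryless_fair_strategies2 G"
    "\<And>\<pi>1 v. strategy G (V1 G) \<pi>1 \<Longrightarrow> expected_reward G r \<pi>1 \<pi>2 v \<le> g v"
proof -
  have "\<exists>x\<in>post G u. g x = (INF u'\<in>post G u. g u')" for u
    using finite_INF_attained[of "post G u" g] post_nonempty[OF G] by (metis finite)
  then obtain \<sigma> where \<sigma>: "\<And>u. \<sigma> u \<in> post G u" "\<And>u. g (\<sigma> u) = (INF u'\<in>post G u. g u')"
    by metis
  show thesis
  proof (rule that)
    show "perturbed_choice G l \<sigma> \<in> memoryless_fair_strategies2 G"
      by (rule perturbed_choice_memoryless_fair[OF G l \<sigma>(1)])
    fix \<pi>1 v assume \<pi>1: "strategy G (V1 G) \<pi>1"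
    show "expected_reward G r \<pi>1 (perturbed_choice G l \<sigma>) v \<le> g v"
    proof (rule expected_reward_le)
      fix h :: "'a list" assume h: "h \<noteq> []"
      have "ennreal (r (last h)) + (\<integral>\<^sup>+u. g u \<partial>next_vertex G \<pi>1 (perturbed_choice G l \<sigma>) h)
          \<le> bellman G r l g (last h)"
      proof (cases rule: vertex_cases[OF G, of "last h"])
        case 1
        have "set_pmf (\<pi>1 h) \<subseteq> post G (last h)"
          using \<pi>1 1(1) h unfolding strategy_def
          by (metis append_butlast_last_id pmf_positive_iff subsetI)
        then show ?thesis
          using 1 by (auto simp: bellman_def next_vertex_def intro!: add_left_mono nn_integral_pmf_le_SUP)
      next
        case 2
        have "(\<integral>\<^sup>+u. g u \<partial>perturbed_choice G l \<sigma> h) = ennreal l * (\<integral>\<^sup>+u. g u \<partial>pmf_of_set (post G (last h)))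
            + ennreal (1 - l) * g (\<sigma> (last h))"
          using l unfolding perturbed_choice_def
          by (simp add: nn_integral_bernoulli_pmf mult.commute)
        then show ?thesis
          using 2 by (simp add: bellman_def next_vertex_def \<sigma>(2) add.commute)
      next
        case 3
        then show ?thesis by (simp add: bellman_def next_vertex_def)
      qed
      also have "\<dots> \<le> g (last h)" using super by (rule le_funD)
      finally show "ennreal (r (last h)) + (\<integral>\<^sup>+u. g u \<partial>next_vertex G \<pi>1 (perturbed_choice G l \<sigma>) h) \<le> g (last h)" .
    qed
  qed
qed

text \<open>Player 1 moves to a successor maximizing \<open>f\<close>; any legal move of Player 2
  yields at least the minimum, which is the Player 2 case of \<open>bellman\<close> at weight
  \<open>0\<close>. Stopping under fairness supplies the almost sure reachability for
  \<open>expected_reward_ge\<close>.\<close>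

lemma bellman_zero_subsolution_guarantee:
  assumes G: "stochastic_game G" and stop: "stopping_under_fairness G"
    and sub: "f \<le> bellman G r 0 f"
    and fin: "\<And>u. f u \<noteq> \<top>" and terminal_zero: "\<And>u. terminal G u \<Longrightarrow> f u = 0"
  obtains \<pi>1 where "\<pi>1 \<in> memoryless_strategies1 G"
    "\<And>\<pi>2 v. fair_strategy G \<pi>2 \<Longrightarrow> f v \<le> expected_reward G r \<pi>1 \<pi>2 v"
proof -
  have "\<exists>x\<in>post G u. f x = (SUP u'\<in>post G u. f u')" for u
    using finite_SUP_attained[of "post G u" f] post_nonempty[OF G] by (metis finite)
  then obtain \<sigma> where \<sigma>: "\<And>u. \<sigma> u \<in> post G u" "\<And>u. f (\<sigma> u) = (SUP u'\<in>post G u. f u')"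
    by metis
  define \<pi>1 :: "'a strategy" where "\<pi>1 = (\<lambda>h. return_pmf (\<sigma> (last h)))"
  have \<pi>1: "strategy G (V1 G) \<pi>1"
    unfolding \<pi>1_def by (rule strategy_lastI) (simp add: \<sigma>(1))
  show thesis
  proof (rule that)
    show "\<pi>1 \<in> memoryless_strategies1 G"
      using \<pi>1 by (simp add: memoryless_strategies1_def memoryless_def \<pi>1_def)
    fix \<pi>2 v assume \<pi>2: "fair_strategy G \<pi>2"
    show "f v \<le> expected_reward G r \<pi>1 \<pi>2 v"
    proof (rule expected_reward_ge)
      fix h :: "'a list" assume h: "h \<noteq> []"
      have "f (last h) \<le> bellman G r 0 f (last h)" using sub by (rule le_funD)
      also have "\<dots> \<le> ennreal (r (last h)) + (\<integral>\<^sup>+u. f u \<partial>next_vertex G \<pi>1 \<pi>2 h)"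
      proof (cases rule: vertex_cases[OF G, of "last h"])
        case 1
        then show ?thesis by (simp add: bellman_def next_vertex_def \<pi>1_def \<sigma>(2))
      next
        case 2
        have "(INF u'\<in>post G (last h). f u') \<le> (\<integral>\<^sup>+u. f u \<partial>next_vertex G \<pi>1 \<pi>2 h)"
          using set_pmf_next_vertex[OF G \<pi>1 _ h] \<pi>2
          by (intro nn_integral_pmf_ge_INF) (simp add: fair_strategy_def)
        then show ?thesis using 2 by (simp add: bellman_def add_left_mono)
      next
        case 3
        then show ?thesis by (simp add: bellman_def next_vertex_def)
      qed
      finally show "f (last h) \<le> ennreal (r (last h)) + (\<integral>\<^sup>+u. f u \<partial>next_vertex G \<pi>1 \<pi>2 h)" .
    next
      show "measure (path_measure G \<pi>1 \<pi>2 v) (reach_terminal G) = 1"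
        using stop \<pi>1 \<pi>2 by (simp add: stopping_under_fairness_def)
    qed (use fin terminal_zero in auto)
  qed
qed

subsection \<open>Stopping games have finite values\<close>

text \<open>The attractor of the terminal vertices when all vertices outside \<open>V1 G\<close>
  cooperate: from \<open>level G k\<close>, whatever Player 1 does, suitable moves of the others
  lead to a terminal vertex within \<open>k\<close> steps.\<close>

primrec level :: "'v game \<Rightarrow> nat \<Rightarrow> 'v set" where
  "level G 0 = {u. terminal G u}"
| "level G (Suc k) = level G k \<union> {u \<in> V1 G. post G u \<subseteq> level G k} \<union>
     {u. u \<notin> V1 G \<and> post G u \<inter> level G k \<noteq> {}}"

lemma level_mono: "i \<le> j \<Longrightarrow> level G i \<subseteq> level G j"
  by (rule lift_Suc_mono_le[of "level G"]) auto

text \<open>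
  On the complement of all levels Player 1 can stay forever and all other vertices cannot leave,
  so no terminal vertex would be reached against the (fair) uniform strategy of Player 2.
\<close>

lemma stopping_imp_level:
  assumes G: "stochastic_game G" and stop: "stopping_under_fairness G"
  shows "\<exists>k. (v :: 'v::finite) \<in> level G k"
proof (rule ccontr)
  define C where "C = - (\<Union>k. level G k)"
  assume "\<nexists>k. v \<in> level G k"
  then have v: "v \<in> C" by (simp add: C_def)
  have stay: "\<exists>x\<in>post G u. x \<in> C" if u: "u \<in> C" "u \<in> V1 G" for u
  proof (rule ccontr)
    assume "\<not> (\<exists>x\<in>post G u. x \<in> C)"
    then have "\<forall>x\<in>post G u. \<exists>k. x \<in> level G k" by (auto simp: C_def)
    then obtain k where k: "\<And>x. x \<in> post G u \<Longrightarrow> x \<in> level G (k x)" by metis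
    \<comment> \<open>\<open>post G u\<close> is finite, so the largest of these levels contains all
      successors.\<close>
    have "x \<in> level G (Max (k ` post G u))" if "x \<in> post G u" for x
      using k[OF that] level_mono[of "k x" "Max (k ` post G u)" G] that by auto
    then have "u \<in> level G (Suc (Max (k ` post G u)))" using u(2) by auto
    then show False using u(1) unfolding C_def by blast
  qed
  have closed: "post G u \<subseteq> C" if u: "u \<in> C" "u \<notin> V1 G" for u
  proof
    fix x assume x: "x \<in> post G u"
    have "x \<notin> level G k" for k
    proof
      assume "x \<in> level G k"
      then have "u \<in> level G (Suc k)" using u(2) x by auto
      then show False using u(1) unfolding C_def by blast
    qed
    then show "x \<in> C" by (simp add: C_def)
  qed
  have "\<exists>x. x \<in> post G u \<and> (u \<in> C \<longrightarrow> u \<in> V1 G \<longrightarrow> x \<in> C)" for u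
    using stay[of u] post_nonempty[OF G, of u] by blast
  then obtain \<sigma> where \<sigma>: "\<And>u. \<sigma> u \<in> post G u" "\<And>u. u \<in> C \<Longrightarrow> u \<in> V1 G \<Longrightarrow> \<sigma> u \<in> C"
    by metis
  define \<pi>1 :: "'v strategy" where "\<pi>1 = (\<lambda>h. return_pmf (\<sigma> (last h)))"
  define \<pi>2 where "\<pi>2 = perturbed_choice G 1 \<sigma>"
  have \<pi>1: "strategy G (V1 G) \<pi>1"
    unfolding \<pi>1_def by (rule strategy_lastI) (simp add: \<sigma>(1))
  have \<pi>2: "fair_strategy G \<pi>2"
    using perturbed_choice_memoryless_fair[OF G _ _ \<sigma>(1), of 1]
    by (simp add: \<pi>2_def memoryless_fair_strategies2_def)
  then have \<pi>2': "strategy G (V2 G) \<pi>2" by (simp add: fair_strategy_def)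
  interpret prob_space "path_measure G \<pi>1 \<pi>2 v" by (rule prob_space_path_measure)
  \<comment> \<open>The indicator of being outside \<open>C\<close> starts at \<open>0\<close> and
    satisfies the supermartingale inequality, so the play almost surely stays in
    \<open>C\<close>.\<close>
  have "AE \<omega> in path_measure G \<pi>1 \<pi>2 v. \<forall>n. of_bool (last (map \<omega> [0..<Suc n]) \<notin> C) = (0::ennreal)"
  proof (rule AE_prefix_zero)
    fix h :: "'v list" assume h: "h \<noteq> []"
    show "(\<integral>\<^sup>+u. of_bool (last (h @ [u]) \<notin> C) \<partial>next_vertex G \<pi>1 \<pi>2 h) \<le> (of_bool (last h \<notin> C) :: ennreal)"
    proof (cases "last h \<in> C")
      case True
      have "set_pmf (next_vertex G \<pi>1 \<pi>2 h) \<subseteq> C"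
      proof (cases "last h \<in> V1 G")
        case V1: True
        then show ?thesis using \<sigma>(2)[OF True V1] by (simp add: next_vertex_def \<pi>1_def)
      next
        case False
        then show ?thesis using set_pmf_next_vertex[OF G \<pi>1 \<pi>2' h] closed[OF True] by blast
      qed
      then have "(\<integral>\<^sup>+u. of_bool (last (h @ [u]) \<notin> C) \<partial>next_vertex G \<pi>1 \<pi>2 h) =
          (\<integral>\<^sup>+u. (0::ennreal) \<partial>next_vertex G \<pi>1 \<pi>2 h)"
        by (intro nn_integral_cong_AE AE_pmfI) auto
      then show ?thesis by simp
    next
      case False
      have "(\<integral>\<^sup>+u. of_bool (last (h @ [u]) \<notin> C) \<partial>next_vertex G \<pi>1 \<pi>2 h) \<le>
          (\<integral>\<^sup>+u. (1::ennreal) \<partial>next_vertex G \<pi>1 \<pi>2 h)"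
        by (intro nn_integral_mono) auto
      then show ?thesis using False by simp
    qed
  qed (use v in simp)
  moreover have "AE \<omega> in path_measure G \<pi>1 \<pi>2 v. \<omega> \<in> reach_terminal G"
    using stop \<pi>1 \<pi>2 by (simp add: stopping_under_fairness_def flip: prob_eq_1)
  ultimately have "AE \<omega> in path_measure G \<pi>1 \<pi>2 v. False"
  proof eventually_elim
    fix \<omega> assume "\<forall>n. of_bool (last (map \<omega> [0..<Suc n]) \<notin> C) = (0::ennreal)" "\<omega> \<in> reach_terminal G"
    then obtain k where "terminal G (\<omega> k)" "\<omega> k \<in> C" by (auto simp: reach_terminal_def)
    moreover from this have "\<omega> k \<in> level G 0" by simp
    ultimately show False unfolding C_def by blast
  qed
  then show False by simp
qed

text \<open>The witness is a potential that grows with the rank, the least level containing a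
  vertex. From positive rank, every move of Player 1 lowers the rank, and any other vertex lowers it
  with probability at least \<open>p\<close>; the potential is steep enough for this to pay for the
  reward.\<close>

lemma ex_finite_supersolution:
  fixes G :: "('v::finite) game"
  assumes G: "stochastic_game G" and r: "reward_function G r" and stop: "stopping_under_fairness G"
  obtains \<phi> :: "'v \<Rightarrow> real" where "\<And>u. 0 \<le> \<phi> u" "\<And>u. terminal G u \<Longrightarrow> \<phi> u = 0"
    "bellman G r 1 (\<lambda>u. ennreal (\<phi> u)) \<le> (\<lambda>u. ennreal (\<phi> u))"
proof -
  \<comment> \<open>Weight \<open>1\<close> leaves Player 2 no choice: every vertex outside
    \<open>V1 G\<close> moves at random by \<open>K\<close>.\<close>
  define K where "K u = (if u \<in> V2 G then pmf_of_set (post G u) else embed_pmf (delta G u))" for u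
  have K: "set_pmf (K u) = post G u" if "u \<notin> V1 G" for u
    using that set_pmf_embed_pmf_delta[OF G, of u] post_nonempty[OF G, of u]
    by (cases rule: vertex_cases[OF G, of u]) (auto simp: K_def)
  have bellman_K: "bellman G r 1 f u = ennreal (r u) + (\<integral>\<^sup>+x. f x \<partial>K u)" if "u \<notin> V1 G" for f u
    using that by (simp add: bellman_def K_def)
  \<comment> \<open>The element \<open>1\<close> keeps \<open>S\<close> nonempty if Player 1 owns
    all vertices, and gives \<open>p \<le> 1\<close>.\<close>
  define S where "S = insert 1 ((\<lambda>(u, u'). pmf (K u) u') ` {(u, u'). u \<notin> V1 G \<and> u' \<in> post G u})"
  define p where "p = Min S"
  have S: "finite S" "S \<noteq> {}" "\<And>x. x \<in> S \<Longrightarrow> 0 < x"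
    using K by (auto simp: S_def pmf_positive)
  have p: "0 < p" "p \<le> 1"
    using S Min_in[OF S(1,2)] by (auto simp: p_def S_def intro: Min_le)
  have p_le: "p \<le> pmf (K u) u'" if "u \<notin> V1 G" "u' \<in> post G u" for u u'
    unfolding p_def using that by (intro Min_le S) (auto simp: S_def)
  define R where "R = Max (range r)"
  have R: "r u \<le> R" for u unfolding R_def by (intro Max_ge) auto
  have R0: "0 \<le> R" using r R[of undefined] by (auto simp: reward_function_def intro: order_trans)
  define rank where "rank u = (LEAST k. u \<in> level G k)" for u
  have rank: "u \<in> level G (rank u)" for u
    unfolding rank_def using stopping_imp_level[OF G stop] by (rule LeastI_ex)
  have rank_le: "rank u \<le> k" if "u \<in> level G k" for u k
    unfolding rank_def using that by (rule Least_le)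
  define N where "N = Max (range rank)"
  have N: "rank u \<le> N" for u unfolding N_def by (intro Max_ge) auto
  \<comment> \<open>\<open>b\<close> grows so fast that gaining \<open>b (Suc j)\<close> with
    probability \<open>p\<close> covers \<open>b j\<close> and one more reward
    \<open>R\<close>.\<close>
  define b :: "nat \<Rightarrow> real" where "b = rec_nat 0 (\<lambda>_ x. (x + R) / p)"
  have b_Suc: "p * b (Suc j) = b j + R" for j using p by (simp add: b_def)
  have b_nonneg: "0 \<le> b j" for j
    by (induction j) (use p R0 in \<open>simp_all add: b_def\<close>)
  have b_step: "b j + R \<le> b (Suc j)" for j
    using mult_right_mono[OF p(2) b_nonneg[of "Suc j"]] by (simp add: b_Suc)
  have b_mono: "b i \<le> b j" if "i \<le> j" for i j
  proof (rule lift_Suc_mono_le[of b, OF _ that])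
    show "b n \<le> b (Suc n)" for n using b_step[of n] R0 by linarith
  qed
  \<comment> \<open>The deficit below the common bound \<open>b N\<close> is
    \<open>b (N - rank u)\<close>, larger for smaller rank; rank \<open>0\<close> gives value
    \<open>0\<close>.\<close>
  define \<phi> where "\<phi> u = b N - b (N - rank u)" for u
  have \<phi>_nonneg: "0 \<le> \<phi> u" for u by (simp add: \<phi>_def b_mono)
  have \<phi>_le: "\<phi> u' \<le> b N - b (N - k)" if "u' \<in> level G k" for u' k
    unfolding \<phi>_def using rank_le[OF that] by (intro diff_left_mono b_mono) simp
  have \<phi>_terminal: "\<phi> u = 0" if "terminal G u" for u
    using rank_le[of u 0] that by (simp add: \<phi>_def)
  have "bellman G r 1 (\<lambda>u. ennreal (\<phi> u)) u \<le> ennreal (\<phi> u)" for u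
  proof (cases "rank u")
    case 0
    then have t: "terminal G u" using rank[of u] by simp
    have "r u = 0" using r t by (simp add: reward_function_def)
    moreover have "(\<integral>\<^sup>+x. ennreal (\<phi> x) \<partial>K u) \<le> ennreal (\<phi> u)" if "u \<notin> V1 G"
      using nn_integral_pmf_le_SUP[of "K u" "{u}" "\<lambda>x. ennreal (\<phi> x)"] K[OF that] post_terminal[OF t]
      by simp
    ultimately show ?thesis
      using post_terminal[OF t] by (cases "u \<in> V1 G") (simp add: bellman_def, simp add: bellman_K)
  next
    case (Suc k)
    then have u: "u \<in> level G (Suc k)" "u \<notin> level G k"
      using rank[of u] rank_le[of u k] by auto
    have j: "N - k = Suc (N - Suc k)" using N[of u] Suc by simp
    have \<phi>u: "\<phi> u = b N - b (N - Suc k)" by (simp add: \<phi>_def Suc)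
    \<comment> \<open>The condition \<open>R \<le> \<phi> u\<close> matters because
      \<open>ennreal\<close> maps negative reals to \<open>0\<close>.\<close>
    have suff: "ennreal (r u) + X \<le> ennreal (\<phi> u)" if "X \<le> ennreal (\<phi> u - R)" "R \<le> \<phi> u" for X
    proof -
      have "ennreal (r u) + X \<le> ennreal R + ennreal (\<phi> u - R)"
        by (intro add_mono that ennreal_leI R)
      also have "\<dots> = ennreal (\<phi> u)" using that R0 by (simp flip: ennreal_plus)
      finally show ?thesis .
    qed
    show ?thesis
    proof (cases "u \<in> V1 G")
      case True
      have le: "\<phi> x \<le> \<phi> u - R" if "x \<in> post G u" for x
        using u True that \<phi>_le[of x k] b_step[of "N - Suc k"] by (auto simp: j \<phi>u)
      obtain x where x: "x \<in> post G u" using post_nonempty[OF G] by blast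
      have "ennreal (r u) + (SUP x\<in>post G u. ennreal (\<phi> x)) \<le> ennreal (\<phi> u)"
        using le le[OF x] \<phi>_nonneg[of x] by (intro suff SUP_least ennreal_leI) auto
      then show ?thesis using True by (simp add: bellman_def)
    next
      case False
      then obtain x where x: "x \<in> post G u" "x \<in> level G k" using u by auto
      have 1: "(\<Sum>y\<in>UNIV. pmf (K u) y) = 1" by (rule sum_pmf_eq_1) auto
      \<comment> \<open>Values are compared through the nonnegative deficits
        \<open>b N - \<phi> y\<close>; the successor \<open>x\<close> of lower rank alone
        contributes at least \<open>b (N - Suc k) + R\<close> to their mean.\<close>
      have "b (N - Suc k) + R = p * b (N - k)" by (simp add: j b_Suc)
      also have "\<dots> \<le> pmf (K u) x * (b N - \<phi> x)"
        using p_le[OF False x(1)] \<phi>_le[OF x(2)] b_nonneg by (intro mult_mono) auto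
      also have "\<dots> \<le> (\<Sum>y\<in>UNIV. pmf (K u) y * (b N - \<phi> y))"
        by (rule member_le_sum) (auto simp: \<phi>_def b_nonneg)
      also have "\<dots> = b N - (\<Sum>y\<in>UNIV. pmf (K u) y * \<phi> y)"
        using 1 by (simp add: right_diff_distrib sum_subtractf flip: sum_distrib_right)
      finally have le: "(\<Sum>y\<in>UNIV. pmf (K u) y * \<phi> y) \<le> \<phi> u - R" by (simp add: \<phi>u)
      have "(\<integral>\<^sup>+y. ennreal (\<phi> y) \<partial>K u) = ennreal (\<Sum>y\<in>UNIV. pmf (K u) y * \<phi> y)"
        by (simp add: nn_integral_measure_pmf nn_integral_count_space_finite \<phi>_nonneg
              sum_ennreal flip: ennreal_mult)
      also have "\<dots> \<le> ennreal (\<phi> u - R)" using le by (rule ennreal_leI)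
      finally have int_le: "(\<integral>\<^sup>+y. ennreal (\<phi> y) \<partial>K u) \<le> ennreal (\<phi> u - R)" .
      have "0 \<le> (\<Sum>y\<in>UNIV. pmf (K u) y * \<phi> y)" by (intro sum_nonneg) (simp add: \<phi>_nonneg)
      then have "R \<le> \<phi> u" using le by simp
      with int_le show ?thesis unfolding bellman_K[OF False] by (rule suff)
    qed
  qed
  then show thesis using that[of \<phi>] \<phi>_nonneg \<phi>_terminal by (auto simp: le_fun_def)
qed

text \<open>The limit passes through all three cases because there are finitely many vertices. For
  Player 2 the forced uniform part has weight \<open>1 / (n + 1)\<close> and a bounded integral, so
  it disappears and weight \<open>0\<close> remains.\<close>

lemma bellman_INF:
  fixes g :: "nat \<Rightarrow> 'v::finite \<Rightarrow> ennreal"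
  assumes G: "stochastic_game G" and fixpoint: "\<And>n. bellman G r (1 / real (Suc n)) (g n) = g n"
    and dec: "decseq g" and \<phi>: "\<And>n u. g n u \<le> ennreal (\<phi> u)"
  shows "(\<lambda>u. INF n. g n u) \<le> bellman G r 0 (\<lambda>u. INF n. g n u)"
proof (rule le_funI)
  fix u
  define w where "w u = (INF n. g n u)" for u
  have w_le: "w u \<le> g n u" for u n unfolding w_def by (rule INF_lower) simp
  have lim: "(\<lambda>n. g n u) \<longlonglongrightarrow> w u" for u
    unfolding w_def
    by (intro LIMSEQ_INF decseq_SucI le_funD[OF decseq_SucD[OF dec]])
  have "w u \<le> bellman G r 0 w u"
  proof (cases rule: vertex_cases[OF G, of u])
    case 1
    have "\<exists>x\<in>post G u. g n x = (SUP x\<in>post G u. g n x)" for n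
      using finite_SUP_attained[of "post G u" "g n"] post_nonempty[OF G] by (metis finite)
    then obtain s where s: "\<And>n. s n \<in> post G u" "\<And>n. g n (s n) = (SUP x\<in>post G u. g n x)"
      by metis
    \<comment> \<open>The maximizers \<open>s n\<close> take finitely many values, so a single
      successor is optimal for arbitrarily large \<open>n\<close>.\<close>
    obtain a where a: "infinite {n. s n = s a}"
      using pigeonhole_infinite[of UNIV s] by auto
    have "w u \<le> ennreal (r u) + g m (s a)" for m
    proof -
      obtain n where n: "m \<le> n" "s n = s a"
        using a by (auto simp: infinite_nat_iff_unbounded_le)
      have "w u \<le> g n u" by (rule w_le)
      also have "\<dots> = bellman G r (1 / real (Suc n)) (g n) u" by (simp only: fixpoint)
      also have "\<dots> = ennreal (r u) + g n (s a)"
        using 1 by (simp add: bellman_def s(2)[of n, symmetric] n(2))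
      also have "\<dots> \<le> ennreal (r u) + g m (s a)"
        by (intro add_left_mono le_funD[OF decseqD[OF dec n(1)]])
      finally show ?thesis .
    qed
    then have "w u \<le> ennreal (r u) + w (s a)"
      by (intro LIMSEQ_le_const[OF tendsto_add[OF tendsto_const lim]]) auto
    also have "\<dots> \<le> ennreal (r u) + (SUP x\<in>post G u. w x)"
      by (intro add_left_mono SUP_upper s)
    finally show ?thesis using 1 by (simp add: bellman_def)
  next
    case 2
    \<comment> \<open>A common real bound for all \<open>g n x\<close>; \<open>max 0\<close> guards
      against negative values of \<open>\<phi>\<close>.\<close>
    define B where "B = (\<Sum>u\<in>UNIV. max 0 (\<phi> u))"
    have "\<phi> x \<le> B" for x
    proof -
      have "\<phi> x \<le> max 0 (\<phi> x)" by simp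
      also have "\<dots> \<le> B" unfolding B_def by (rule member_le_sum) auto
      finally show ?thesis .
    qed
    then have B: "g n x \<le> ennreal B" for n x
      using \<phi> by (meson ennreal_leI order_trans)
    have *: "w u \<le> ennreal (r u) + w x" if x: "x \<in> post G u" for x
    proof -
      have "w u \<le> ennreal (r u) + (g n x + ennreal (1 / real (Suc n) * B))" for n
      proof -
        have "w u \<le> g n u" by (rule w_le)
        also have "\<dots> = bellman G r (1 / real (Suc n)) (g n) u" by (simp only: fixpoint)
        also have "\<dots> = ennreal (r u) + (ennreal (1 - 1 / real (Suc n)) * (INF x\<in>post G u. g n x) +
            ennreal (1 / real (Suc n)) * (\<integral>\<^sup>+x. g n x \<partial>pmf_of_set (post G u)))"
          using 2 by (simp add: bellman_def)
        \<comment> \<open>The first weight is replaced by \<open>1\<close> and the minimum by the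
          value at the fixed successor \<open>x\<close>; the second weight is kept, since it tends
          to \<open>0\<close>.\<close>
        also have "\<dots> \<le> ennreal (r u) + (1 * g n x + ennreal (1 / real (Suc n)) * (\<integral>\<^sup>+x. ennreal B \<partial>pmf_of_set (post G u)))"
        proof (intro add_left_mono add_mono mult_mono)
          show "ennreal (1 - 1 / real (Suc n)) \<le> 1" unfolding ennreal_1[symmetric] by (intro ennreal_leI) simp
          show "(INF x\<in>post G u. g n x) \<le> g n x" using x by (rule INF_lower)
          show "(\<integral>\<^sup>+x. g n x \<partial>pmf_of_set (post G u)) \<le> (\<integral>\<^sup>+x. ennreal B \<partial>pmf_of_set (post G u))"
            by (intro nn_integral_mono B)
        qed auto
        also have "\<dots> = ennreal (r u) + (g n x + ennreal (1 / real (Suc n) * B))"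
          by (simp add: measure_pmf.emeasure_space_1[simplified] B_def sum_nonneg flip: ennreal_mult)
        finally show ?thesis .
      qed
      moreover have "(\<lambda>n. ennreal (1 / real (Suc n) * B)) \<longlonglongrightarrow> ennreal (0 * B)"
        by (intro tendsto_ennrealI tendsto_mult tendsto_const)
          (use LIMSEQ_inverse_real_of_nat in \<open>simp add: inverse_eq_divide\<close>)
      then have "(\<lambda>n. ennreal (r u) + (g n x + ennreal (1 / real (Suc n) * B))) \<longlonglongrightarrow> ennreal (r u) + (w x + ennreal (0 * B))"
        by (intro tendsto_add tendsto_const lim)
      ultimately have "w u \<le> ennreal (r u) + (w x + ennreal (0 * B))"
        by (intro LIMSEQ_le_const) auto
      then show ?thesis by simp
    qed
    obtain x where x: "x \<in> post G u" "w x = (INF x\<in>post G u. w x)"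
      using finite_INF_attained[of "post G u" w] post_nonempty[OF G] by (metis finite)
    show ?thesis using *[OF x(1)] 2 by (simp add: bellman_def x(2))
  next
    case 3
    have "(\<lambda>n. \<integral>\<^sup>+x. g n x \<partial>embed_pmf (delta G u)) \<longlonglongrightarrow> (\<integral>\<^sup>+x. w x \<partial>embed_pmf (delta G u))"
      unfolding nn_integral_measure_pmf
      by (simp add: nn_integral_count_space_finite)
        (intro tendsto_sum ennreal_tendsto_cmult lim; simp)
    then have "(\<lambda>n. ennreal (r u) + (\<integral>\<^sup>+x. g n x \<partial>embed_pmf (delta G u))) \<longlonglongrightarrow>
        ennreal (r u) + (\<integral>\<^sup>+x. w x \<partial>embed_pmf (delta G u))"
      by (intro tendsto_add tendsto_const)
    moreover have "w u \<le> ennreal (r u) + (\<integral>\<^sup>+x. g n x \<partial>embed_pmf (delta G u))" for n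
      using w_le[of u n] fixpoint[of n, THEN fun_cong, of u] 3 by (simp add: bellman_def)
    ultimately have "w u \<le> ennreal (r u) + (\<integral>\<^sup>+x. w x \<partial>embed_pmf (delta G u))"
      by (intro LIMSEQ_le_const) auto
    then show ?thesis using 3 by (simp add: bellman_def)
  qed
  then show "(INF n. g n u) \<le> bellman G r 0 (\<lambda>u. INF n. g n u) u"
    by (simp add: w_def[abs_def])
qed

section \<open>Comparison of the two suprema\<close>

theorem theorem8:
  fixes G :: "('v::finite) game" and r :: "'v \<Rightarrow> real" and v :: 'v
  assumes "stochastic_game G"
    and "reward_function G r"
    and "stopping_under_fairness G"
  shows "(SUP \<pi>1\<in>semi_Markov_strategies1 G. INF \<pi>2\<in>memoryless_fair_strategies2 G.
            expected_reward G r \<pi>1 \<pi>2 v) =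
         (SUP \<pi>1\<in>memoryless_strategies1 G. INF \<pi>2\<in>memoryless_fair_strategies2 G.
            expected_reward G r \<pi>1 \<pi>2 v)"
proof (rule antisym)
  let ?E = "\<lambda>\<pi>1 \<pi>2. expected_reward G r \<pi>1 \<pi>2 v"
  have "memoryless (V1 G) \<pi>1 \<Longrightarrow> semi_Markov (V1 G) \<pi>1" for \<pi>1
    unfolding memoryless_def semi_Markov_def by (metis append_Cons)
  then have "memoryless_strategies1 G \<subseteq> semi_Markov_strategies1 G"
    by (auto simp: memoryless_strategies1_def semi_Markov_strategies1_def)
  then show "(SUP \<pi>1\<in>memoryless_strategies1 G. INF \<pi>2\<in>memoryless_fair_strategies2 G. ?E \<pi>1 \<pi>2)
      \<le> (SUP \<pi>1\<in>semi_Markov_strategies1 G. INF \<pi>2\<in>memoryless_fair_strategies2 G. ?E \<pi>1 \<pi>2)"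
    by (rule SUP_subset_mono) simp
  obtain \<phi> :: "'v \<Rightarrow> real" where \<phi>: "\<And>u. terminal G u \<Longrightarrow> \<phi> u = 0"
    "bellman G r 1 (\<lambda>u. ennreal (\<phi> u)) \<le> (\<lambda>u. ennreal (\<phi> u))"
    using ex_finite_supersolution[OF assms] by metis
  \<comment> \<open>Positive weights keep the minimizing answers of Player 2 fair; for
    \<open>n = 0\<close> the weight is \<open>1\<close>, for which \<open>\<phi>\<close> is a
    supersolution.\<close>
  define g where "g n = lfp (bellman G r (1 / real (Suc n)))" for n
  have fixpoint: "bellman G r (1 / real (Suc n)) (g n) = g n" for n
    unfolding g_def by (rule lfp_unfold[symmetric]) (simp add: mono_def bellman_mono)
  have dec: "decseq g"
    unfolding decseq_def g_def
    by (intro allI impI lfp_mono bellman_mono_param assms(1)) (auto simp: frac_le)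
  have "g 0 \<le> (\<lambda>u. ennreal (\<phi> u))"
    unfolding g_def using \<phi>(2) by (intro lfp_lowerbound) simp
  then have g_le: "g n u \<le> ennreal (\<phi> u)" for n u
    using decseqD[OF dec, of 0 n] by (auto simp: le_fun_def intro: order_trans)
  define w where "w u = (INF n. g n u)" for u
  have w_le: "w u \<le> ennreal (\<phi> u)" for u
    unfolding w_def using g_le[of 0 u] by (intro INF_lower2[of 0]) auto
  have "w \<le> bellman G r 0 w"
    unfolding w_def[abs_def] by (rule bellman_INF[OF assms(1) fixpoint dec g_le])
  moreover have "w u \<noteq> \<top>" for u using w_le[of u] by (auto simp: top_unique)
  moreover have "w u = 0" if "terminal G u" for u using w_le[of u] \<phi>(1)[OF that] by simp
  ultimately obtain \<pi>1 where \<pi>1: "\<pi>1 \<in> memoryless_strategies1 G"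
    "\<And>\<pi>2 v. fair_strategy G \<pi>2 \<Longrightarrow> w v \<le> expected_reward G r \<pi>1 \<pi>2 v"
    using bellman_zero_subsolution_guarantee[OF assms(1,3), of w r] by metis
  \<comment> \<open>A single fair memoryless \<open>\<pi>2\<close> keeps every strategy of Player 1
    at or below \<open>g n v\<close>, in particular the semi-Markov ones.\<close>
  have "(SUP \<pi>1\<in>semi_Markov_strategies1 G. INF \<pi>2\<in>memoryless_fair_strategies2 G. ?E \<pi>1 \<pi>2) \<le> g n v" for n
  proof (rule SUP_least)
    obtain \<pi>2 where \<pi>2: "\<pi>2 \<in> memoryless_fair_strategies2 G"
      "\<And>\<pi>1 v. strategy G (V1 G) \<pi>1 \<Longrightarrow> expected_reward G r \<pi>1 \<pi>2 v \<le> g n v"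
      by (rule bellman_supersolution_guarantee[OF assms(1), of "1 / real (Suc n)" r "g n"])
        (use fixpoint[of n] in \<open>auto simp del: of_nat_Suc\<close>)
    fix \<pi>1 assume "\<pi>1 \<in> semi_Markov_strategies1 G"
    then show "(INF \<pi>2\<in>memoryless_fair_strategies2 G. ?E \<pi>1 \<pi>2) \<le> g n v"
      by (intro INF_lower2[OF \<pi>2(1)] \<pi>2(2)) (simp add: semi_Markov_strategies1_def)
  qed
  then have "(SUP \<pi>1\<in>semi_Markov_strategies1 G. INF \<pi>2\<in>memoryless_fair_strategies2 G. ?E \<pi>1 \<pi>2) \<le> w v"
    unfolding w_def by (rule INF_greatest)
  also have "w v \<le> (INF \<pi>2\<in>memoryless_fair_strategies2 G. ?E \<pi>1 \<pi>2)"
    by (intro INF_greatest \<pi>1(2)) (simp add: memoryless_fair_strategies2_def)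
  also have "\<dots> \<le> (SUP \<pi>1\<in>memoryless_strategies1 G. INF \<pi>2\<in>memoryless_fair_strategies2 G. ?E \<pi>1 \<pi>2)"
    using \<pi>1(1) by (rule SUP_upper)
  finally show "(SUP \<pi>1\<in>semi_Markov_strategies1 G. INF \<pi>2\<in>memoryless_fair_strategies2 G. ?E \<pi>1 \<pi>2)
      \<le> (SUP \<pi>1\<in>memoryless_strategies1 G. INF \<pi>2\<in>memoryless_fair_strategies2 G. ?E \<pi>1 \<pi>2)" .
qed

end
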